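(* Let $t\in\mathbb R\setminus\{0\}$. An $\mathbb H_t^{n\times n}$-valued rational function $\phi$ with minimal realization $\phi(x)=D+xC(I_{\mathbb H_t^N}-xA)^{-1}B$ satisfies $$\phi(x)=-(\phi(-x))^{\circledast}$$ at the real points where it is defined if and only if there exists an invertible matrix $H\in\mathbb H_t^{N\times N}$ with $H=H^{\circledast}$ such that $$D+D^{\circledast}=0,\qquad A^{\circledast}H+HA=0,\qquad B=H^{-1}C^{\circledast}.$$ Furthermore, $H$ is uniquely determined by the realization, and $$\phi(x)=D+xC(I_{\mathbb H_t^N}-xA)^{-1}H^{-1}C^{\circledast},$$ $$\frac{\phi(x)+(\phi(y))^{\circledast}}{x+y}=C(I_{\mathbb H_t^N}-xA)^{-1}H^{-1}(I_{\mathbb H_t^N}-yA^{\circledast})^{-1}C^{\circledast}$$ for real $x,y$ for which both sides are defined.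
   Context: For real $t\neq 0$, $\mathbb H_t$ is the real associative algebra of elements $q=a+bj_t$ with $a,b\in\mathbb C$, where $\mathbb C\subset\mathbb H_t$, $j_t^2=t$ and $j_t a=\overline a\, j_t$ for $a\in\mathbb C$. For $q=a+bj_t$ set $q^{\circledast}=\overline a-bj_t$; for a matrix $M=(m_{jk})$ over $\mathbb H_t$, $M^{\circledast}$ is the matrix whose $(j,k)$ entry is $m_{kj}^{\circledast}$. $I_{\mathbb H_t^N}$ is the identity matrix in $\mathbb H_t^{N\times N}$. The variable $x$ is real. An $\mathbb H_t^{n\times n}$-valued function $\phi$ of the real variable $x$, defined at $x=0$, is rational if it can be written as $\phi(x)=D+xC(I_{\mathbb H_t^N}-xA)^{-1}B$ with $D=\phi(0)$ and $(C,A,B)\in\mathbb H_t^{n\times N}\times\mathbb H_t^{N\times N}\times\mathbb H_t^{N\times n}$ (a realization). The pair $(C,A)$ is observable if for $h\in\mathbb H_t^N$: $C(I_{\mathbb H_t^N}-xA)^{-1}h=0$ for all $x$ in some interval $(-\varepsilon,\varepsilon)$ if and only if $h=0$. The pair $(A,B)$ is controllable if for $h\in\mathbb H_t^{1\times N}$: $hA^kB=0$ for all $k=0,1,2,\ldots$ if and only if $h=0$. The realization is minimal if $(C,A)$ is observable and $(A,B)$ is controllable. *)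

theory Defs
  imports "HOL-Analysis.Product_Vector" "Jordan_Normal_Form.Matrix"
begin

text \<open>
  The pair \<open>(a, b)\<close> stands for \<open>a + b j\<^sub>t\<close>. The real vector space structure (and hence addition,
  subtraction and zero of matrices) is that of \<^typ>\<open>complex \<times> complex\<close> and does not depend on \<open>t\<close>;
  the product does.
\<close>

type_synonym ht = "complex \<times> complex"

text \<open>\<open>(a + b j\<^sub>t) (c + d j\<^sub>t) = a c + b j\<^sub>t d j\<^sub>t + a d j\<^sub>t + b j\<^sub>t c\<close>, with \<open>j\<^sub>t z = cnj z j\<^sub>t\<close> and
  \<open>j\<^sub>t j\<^sub>t = t\<close>.\<close>

definition ht_mult :: "ht \<Rightarrow> real \<Rightarrow> ht \<Rightarrow> ht"  ("(_ \<cdot>\<^bsub>_\<^esub> _)" [70, 0, 71] 70) where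
  "p \<cdot>\<^bsub>t\<^esub> q = (fst p * fst q + of_real t * snd p * cnj (snd q), fst p * snd q + snd p * cnj (fst q))"

definition ht_of_complex :: "complex \<Rightarrow> ht" where
  "ht_of_complex a = (a, 0)"

definition ht_one :: ht where
  "ht_one = ht_of_complex 1"

definition ht_j :: ht where
  "ht_j = (0, 1)"

definition ht_conj :: "ht \<Rightarrow> ht" where
  "ht_conj q = (cnj (fst q), - snd q)"

lemma ht_decompose: "q = ht_of_complex (fst q) + ht_of_complex (snd q) \<cdot>\<^bsub>t\<^esub> ht_j"
  by (simp add: ht_mult_def ht_of_complex_def ht_j_def)

lemma ht_j_squared: "ht_j \<cdot>\<^bsub>t\<^esub> ht_j = ht_of_complex (of_real t)"
  by (simp add: ht_mult_def ht_of_complex_def ht_j_def)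

lemma ht_j_mult_complex: "ht_j \<cdot>\<^bsub>t\<^esub> ht_of_complex a = ht_of_complex (cnj a) \<cdot>\<^bsub>t\<^esub> ht_j"
  by (simp add: ht_mult_def ht_of_complex_def ht_j_def)

lemma ht_of_complex_mult: "ht_of_complex a \<cdot>\<^bsub>t\<^esub> ht_of_complex b = ht_of_complex (a * b)"
  by (simp add: ht_mult_def ht_of_complex_def)

lemma ht_mult_assoc: "(p \<cdot>\<^bsub>t\<^esub> q) \<cdot>\<^bsub>t\<^esub> r = p \<cdot>\<^bsub>t\<^esub> (q \<cdot>\<^bsub>t\<^esub> r)"
  by (simp add: ht_mult_def algebra_simps)

lemma ht_mult_one [simp]: "ht_one \<cdot>\<^bsub>t\<^esub> q = q" "q \<cdot>\<^bsub>t\<^esub> ht_one = q"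
  by (simp_all add: ht_mult_def ht_one_def ht_of_complex_def)

lemma ht_mult_zero [simp]: "0 \<cdot>\<^bsub>t\<^esub> q = 0" "q \<cdot>\<^bsub>t\<^esub> 0 = 0"
  by (simp_all add: ht_mult_def zero_prod_def)

lemma ht_mult_distrib:
  "(p + q) \<cdot>\<^bsub>t\<^esub> r = p \<cdot>\<^bsub>t\<^esub> r + q \<cdot>\<^bsub>t\<^esub> r" "p \<cdot>\<^bsub>t\<^esub> (q + r) = p \<cdot>\<^bsub>t\<^esub> q + p \<cdot>\<^bsub>t\<^esub> r"
  by (simp_all add: ht_mult_def algebra_simps prod_eq_iff)

lemma ht_mult_scaleR:
  "(c *\<^sub>R p) \<cdot>\<^bsub>t\<^esub> q = c *\<^sub>R (p \<cdot>\<^bsub>t\<^esub> q)" "p \<cdot>\<^bsub>t\<^esub> (c *\<^sub>R q) = c *\<^sub>R (p \<cdot>\<^bsub>t\<^esub> q)"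
  by (simp_all add: ht_mult_def scaleR_conv_of_real algebra_simps prod_eq_iff)

lemma ht_conj_eq: "ht_conj q = ht_of_complex (cnj (fst q)) - ht_of_complex (snd q) \<cdot>\<^bsub>t\<^esub> ht_j"
  by (simp add: ht_conj_def ht_mult_def ht_of_complex_def ht_j_def)

lemma ht_conj_mult: "ht_conj (p \<cdot>\<^bsub>t\<^esub> q) = ht_conj q \<cdot>\<^bsub>t\<^esub> ht_conj p"
  by (simp add: ht_mult_def ht_conj_def algebra_simps)

text \<open>
  The product and the unit of the library's matrices use the type class structure of the entries, which
  cannot depend on \<open>t\<close>, so the multiplicative part is defined here. Columns \<open>h \<in> H\<^sub>t\<^sup>N\<close> are
  \<open>N \<times> 1\<close> matrices and rows are \<open>1 \<times> N\<close> matrices.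
\<close>

definition htm_mult :: "ht mat \<Rightarrow> real \<Rightarrow> ht mat \<Rightarrow> ht mat"  ("(_ \<odot>\<^bsub>_\<^esub> _)" [70, 0, 71] 70) where
  "M \<odot>\<^bsub>t\<^esub> K = mat (dim_row M) (dim_col K) (\<lambda>(i, j). \<Sum>k<dim_col M. M $$ (i, k) \<cdot>\<^bsub>t\<^esub> K $$ (k, j))"

definition htm_one :: "nat \<Rightarrow> ht mat" where
  "htm_one N = mat N N (\<lambda>(i, j). if i = j then ht_one else 0)"

definition htm_scale :: "real \<Rightarrow> ht mat \<Rightarrow> ht mat"  (infixr "*\<^sub>h" 75) where
  "x *\<^sub>h M = map_mat (scaleR x) M"

definition htm_adj :: "ht mat \<Rightarrow> ht mat"  ("(_\<^sup>\<circledast>)" [1000] 999) where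
  "M\<^sup>\<circledast> = map_mat ht_conj (transpose_mat M)"

primrec htm_pow :: "real \<Rightarrow> ht mat \<Rightarrow> nat \<Rightarrow> ht mat" where
  "htm_pow t M 0 = htm_one (dim_row M)"
| "htm_pow t M (Suc k) = htm_pow t M k \<odot>\<^bsub>t\<^esub> M"

definition htm_inverse_of :: "real \<Rightarrow> ht mat \<Rightarrow> ht mat \<Rightarrow> bool" where
  "htm_inverse_of t M K \<longleftrightarrow> square_mat M \<and> K \<in> carrier_mat (dim_row M) (dim_row M) \<and>
     M \<odot>\<^bsub>t\<^esub> K = htm_one (dim_row M) \<and> K \<odot>\<^bsub>t\<^esub> M = htm_one (dim_row M)"

definition htm_invertible :: "real \<Rightarrow> ht mat \<Rightarrow> bool" where
  "htm_invertible t M \<longleftrightarrow> (\<exists>K. htm_inverse_of t M K)"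

definition htm_inv :: "real \<Rightarrow> ht mat \<Rightarrow> ht mat" where
  "htm_inv t M = (THE K. htm_inverse_of t M K)"

lemma ht_mult_sum:
  "(\<Sum>i\<in>S. f i) \<cdot>\<^bsub>t\<^esub> q = (\<Sum>i\<in>S. f i \<cdot>\<^bsub>t\<^esub> q)" "q \<cdot>\<^bsub>t\<^esub> (\<Sum>i\<in>S. f i) = (\<Sum>i\<in>S. q \<cdot>\<^bsub>t\<^esub> f i)"
  by (induction S rule: infinite_finite_induct) (simp_all add: ht_mult_distrib)

lemma htm_mult_assoc:
  assumes "dim_col L = dim_row M" "dim_col M = dim_row K"
  shows "(L \<odot>\<^bsub>t\<^esub> M) \<odot>\<^bsub>t\<^esub> K = L \<odot>\<^bsub>t\<^esub> (M \<odot>\<^bsub>t\<^esub> K)"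
proof (rule eq_matI)
  fix i j assume "i < dim_row (L \<odot>\<^bsub>t\<^esub> (M \<odot>\<^bsub>t\<^esub> K))" "j < dim_col (L \<odot>\<^bsub>t\<^esub> (M \<odot>\<^bsub>t\<^esub> K))"
  then show "((L \<odot>\<^bsub>t\<^esub> M) \<odot>\<^bsub>t\<^esub> K) $$ (i, j) = (L \<odot>\<^bsub>t\<^esub> (M \<odot>\<^bsub>t\<^esub> K)) $$ (i, j)"
    using assms
    by (simp add: htm_mult_def ht_mult_sum ht_mult_assoc)
      (rule sum.swap)
qed (simp_all add: htm_mult_def)

lemma htm_mult_one:
  "dim_row M = N \<Longrightarrow> htm_one N \<odot>\<^bsub>t\<^esub> M = M" "dim_col M = N \<Longrightarrow> M \<odot>\<^bsub>t\<^esub> htm_one N = M"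
  by (auto intro!: eq_matI simp: htm_mult_def htm_one_def if_distrib[of "\<lambda>p. p \<cdot>\<^bsub>t\<^esub> _"]
      if_distrib[of "\<lambda>p. _ \<cdot>\<^bsub>t\<^esub> p"] cong: if_cong)

lemma htm_inv_eqI:
  assumes "htm_inverse_of t M K"
  shows "htm_inv t M = K"
  unfolding htm_inv_def
proof (rule the_equality)
  fix L assume L: "htm_inverse_of t M L"
  have "L = L \<odot>\<^bsub>t\<^esub> (M \<odot>\<^bsub>t\<^esub> K)"
    using assms L by (auto simp: htm_inverse_of_def htm_mult_one)
  also have "\<dots> = (L \<odot>\<^bsub>t\<^esub> M) \<odot>\<^bsub>t\<^esub> K"
    using assms L by (subst htm_mult_assoc) (auto simp: htm_inverse_of_def)
  also have "\<dots> = K"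
    using assms L by (auto simp: htm_inverse_of_def htm_mult_one)
  finally show "L = K" .
qed (fact assms)

definition ht_resolvent :: "real \<Rightarrow> ht mat \<Rightarrow> real \<Rightarrow> ht mat" where
  "ht_resolvent t A x = htm_inv t (htm_one (dim_row A) - x *\<^sub>h A)"

definition ht_regular :: "real \<Rightarrow> ht mat \<Rightarrow> real \<Rightarrow> bool" where
  "ht_regular t A x \<longleftrightarrow> htm_invertible t (htm_one (dim_row A) - x *\<^sub>h A)"

text \<open>
  A rational function is a partial function of the real variable; it is defined exactly at the points
  where the inverse occurring in the realization exists.
\<close>

definition ht_realization ::
  "real \<Rightarrow> nat \<Rightarrow> nat \<Rightarrow> (real \<rightharpoonup> ht mat) \<Rightarrow> ht mat \<Rightarrow> ht mat \<Rightarrow> ht mat \<Rightarrow> ht mat \<Rightarrow> bool" where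
  "ht_realization t n N \<phi> D C A B \<longleftrightarrow>
     D \<in> carrier_mat n n \<and> C \<in> carrier_mat n N \<and> A \<in> carrier_mat N N \<and> B \<in> carrier_mat N n \<and>
     dom \<phi> = {x. ht_regular t A x} \<and> \<phi> 0 = Some D \<and>
     (\<forall>x\<in>dom \<phi>. \<phi> x = Some (D + x *\<^sub>h (C \<odot>\<^bsub>t\<^esub> ht_resolvent t A x \<odot>\<^bsub>t\<^esub> B)))"

definition ht_rational :: "real \<Rightarrow> nat \<Rightarrow> (real \<rightharpoonup> ht mat) \<Rightarrow> bool" where
  "ht_rational t n \<phi> \<longleftrightarrow> (\<exists>N D C A B. ht_realization t n N \<phi> D C A B)"

definition ht_observable :: "real \<Rightarrow> nat \<Rightarrow> nat \<Rightarrow> ht mat \<Rightarrow> ht mat \<Rightarrow> bool" where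
  "ht_observable t n N C A \<longleftrightarrow>
     (\<forall>h\<in>carrier_mat N 1.
        (\<exists>\<epsilon>>0. \<forall>x\<in>{-\<epsilon><..<\<epsilon>}. ht_regular t A x \<and> C \<odot>\<^bsub>t\<^esub> ht_resolvent t A x \<odot>\<^bsub>t\<^esub> h = 0\<^sub>m n 1)
        \<longleftrightarrow> h = 0\<^sub>m N 1)"

definition ht_controllable :: "real \<Rightarrow> nat \<Rightarrow> nat \<Rightarrow> ht mat \<Rightarrow> ht mat \<Rightarrow> bool" where
  "ht_controllable t n N A B \<longleftrightarrow>
     (\<forall>h\<in>carrier_mat 1 N. (\<forall>k. h \<odot>\<^bsub>t\<^esub> htm_pow t A k \<odot>\<^bsub>t\<^esub> B = 0\<^sub>m 1 n) \<longleftrightarrow> h = 0\<^sub>m 1 N)"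

definition ht_minimal_realization ::
  "real \<Rightarrow> nat \<Rightarrow> nat \<Rightarrow> (real \<rightharpoonup> ht mat) \<Rightarrow> ht mat \<Rightarrow> ht mat \<Rightarrow> ht mat \<Rightarrow> ht mat \<Rightarrow> bool" where
  "ht_minimal_realization t n N \<phi> D C A B \<longleftrightarrow>
     ht_realization t n N \<phi> D C A B \<and> ht_observable t n N C A \<and> ht_controllable t n N A B"

definition ht_associated ::
  "real \<Rightarrow> nat \<Rightarrow> nat \<Rightarrow> ht mat \<Rightarrow> ht mat \<Rightarrow> ht mat \<Rightarrow> ht mat \<Rightarrow> ht mat \<Rightarrow> bool" where
  "ht_associated t n N D C A B H \<longleftrightarrow>
     H \<in> carrier_mat N N \<and> htm_invertible t H \<and> H = H\<^sup>\<circledast> \<and>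
     D + D\<^sup>\<circledast> = 0\<^sub>m n n \<and>
     A\<^sup>\<circledast> \<odot>\<^bsub>t\<^esub> H + H \<odot>\<^bsub>t\<^esub> A = 0\<^sub>m N N \<and>
     B = htm_inv t H \<odot>\<^bsub>t\<^esub> C\<^sup>\<circledast>"

end

theory Submission
  imports Defs "HOL-Library.Function_Algebras"
begin

text \<open>
  The function \<open>x \<mapsto> - (\<phi> (-x))\<^sup>\<circledast>\<close> has the realization with data \<open>- D\<^sup>\<circledast>\<close> and
  \<open>(B\<^sup>\<circledast>, - A\<^sup>\<circledast>, C\<^sup>\<circledast>)\<close> in place of \<open>D\<close> and \<open>(C, A, B)\<close>, and this realization is again minimal. If it
  is the same function as \<open>\<phi>\<close>, then two minimal realizations agree and are related by a unique
  invertible change of state \<open>H\<close> with \<open>B\<^sup>\<circledast> H = C\<close>, \<open>H A = - A\<^sup>\<circledast> H\<close> and \<open>H B = C\<^sup>\<circledast>\<close>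
  (\<open>state_space_isomorphism\<close>). These relations are invariant under taking adjoints, so \<open>H\<^sup>\<circledast>\<close> satisfies
  them as well and uniqueness gives \<open>H = H\<^sup>\<circledast>\<close>; they are the conditions on \<open>H\<close> in the theorem.
  Conversely, such an \<open>H\<close> makes \<open>\<phi> x + (\<phi> y)\<^sup>\<circledast>\<close> equal to \<open>x + y\<close> times a kernel
  (\<open>ht_associated_kernel_identity\<close>); setting \<open>y = - x\<close> gives the symmetry, and dividing by \<open>x + y\<close> the
  last formula.
  
  For \<open>t > 0\<close> the algebra \<open>H\<^sub>t\<close> is isomorphic to the real \<open>2 \<times> 2\<close> matrices and has zero divisors, so linear
  algebra over a division ring is not at hand for the state space isomorphism. What remains for every
  \<open>t \<noteq> 0\<close> is the nondegenerate real trace form: by duality with respect to it, a controllable pair has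
  the property that the columns \<open>A\<^sup>k B w\<close> span the state space over the reals
  (\<open>controllable_columns_span\<close>). The isomorphism is then defined by matching states with equal outputs
  \<open>C A\<^sup>k v\<close>, and all its properties are read off from observability.
  
  The passage between values near \<open>0\<close> and the coefficients \<open>C A\<^sup>k B\<close> is made by the Neumann series of the
  resolvent, entry by entry (\<open>resolvent_sums\<close>, \<open>markov_parameters_eq\<close>).
\<close>

section \<open>Matrix algebra over \<open>H\<^sub>t\<close>\<close>

lemma htm_mult_carrier [simp]:
  "L \<in> carrier_mat a b \<Longrightarrow> M \<in> carrier_mat b c \<Longrightarrow> L \<odot>\<^bsub>t\<^esub> M \<in> carrier_mat a c"
  by (auto simp: htm_mult_def)

lemma htm_one_carrier [simp]: "htm_one N \<in> carrier_mat N N"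
  by (simp add: htm_one_def)

lemma htm_scale_carrier [simp]: "x *\<^sub>h M \<in> carrier_mat a b \<longleftrightarrow> M \<in> carrier_mat a b"
  by (auto simp: htm_scale_def)

lemma htm_adj_carrier [simp]: "M\<^sup>\<circledast> \<in> carrier_mat a b \<longleftrightarrow> M \<in> carrier_mat b a"
  by (auto simp: htm_adj_def)

lemma htm_pow_carrier [simp]: "M \<in> carrier_mat N N \<Longrightarrow> htm_pow t M k \<in> carrier_mat N N"
  by (induction k) auto

lemma htm_index_mult:
  "L \<in> carrier_mat a b \<Longrightarrow> M \<in> carrier_mat b c \<Longrightarrow> i < a \<Longrightarrow> j < c \<Longrightarrow>
    (L \<odot>\<^bsub>t\<^esub> M) $$ (i, j) = (\<Sum>k<b. L $$ (i, k) \<cdot>\<^bsub>t\<^esub> M $$ (k, j))"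
  by (auto simp: htm_mult_def)

lemma htm_assoc:
  assumes "L \<in> carrier_mat a b" "M \<in> carrier_mat b c" "K \<in> carrier_mat c d"
  shows "(L \<odot>\<^bsub>t\<^esub> M) \<odot>\<^bsub>t\<^esub> K = L \<odot>\<^bsub>t\<^esub> (M \<odot>\<^bsub>t\<^esub> K)"
  using assms by (intro htm_mult_assoc) auto

lemma htm_one_left [simp]: "M \<in> carrier_mat N c \<Longrightarrow> htm_one N \<odot>\<^bsub>t\<^esub> M = M"
  by (intro htm_mult_one(1)) auto

lemma htm_one_right [simp]: "M \<in> carrier_mat a N \<Longrightarrow> M \<odot>\<^bsub>t\<^esub> htm_one N = M"
  by (intro htm_mult_one(2)) auto

lemma htm_add_mult:
  assumes "L \<in> carrier_mat a b" "L' \<in> carrier_mat a b" "M \<in> carrier_mat b c"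
  shows "(L + L') \<odot>\<^bsub>t\<^esub> M = L \<odot>\<^bsub>t\<^esub> M + L' \<odot>\<^bsub>t\<^esub> M"
  using assms by (intro eq_matI) (auto simp: htm_mult_def ht_mult_distrib sum.distrib)

lemma htm_mult_add:
  assumes "L \<in> carrier_mat a b" "M \<in> carrier_mat b c" "M' \<in> carrier_mat b c"
  shows "L \<odot>\<^bsub>t\<^esub> (M + M') = L \<odot>\<^bsub>t\<^esub> M + L \<odot>\<^bsub>t\<^esub> M'"
  using assms by (intro eq_matI) (auto simp: htm_mult_def ht_mult_distrib sum.distrib)

lemma htm_scale_mult:
  assumes "L \<in> carrier_mat a b" "M \<in> carrier_mat b c"
  shows "(x *\<^sub>h L) \<odot>\<^bsub>t\<^esub> M = x *\<^sub>h (L \<odot>\<^bsub>t\<^esub> M)"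
  using assms
  by (intro eq_matI) (auto simp: htm_mult_def htm_scale_def ht_mult_scaleR scaleR_sum_right)

lemma htm_mult_scale:
  assumes "L \<in> carrier_mat a b" "M \<in> carrier_mat b c"
  shows "L \<odot>\<^bsub>t\<^esub> (x *\<^sub>h M) = x *\<^sub>h (L \<odot>\<^bsub>t\<^esub> M)"
  using assms
  by (intro eq_matI) (auto simp: htm_mult_def htm_scale_def ht_mult_scaleR scaleR_sum_right)

lemma htm_scale_simps [simp]:
  "M \<in> carrier_mat a b \<Longrightarrow> 0 *\<^sub>h M = 0\<^sub>m a b"
  "1 *\<^sub>h M = M"
  "x *\<^sub>h (y *\<^sub>h M) = (x * y) *\<^sub>h M"
  "x *\<^sub>h 0\<^sub>m a b = 0\<^sub>m a b"
  by (auto intro!: eq_matI simp: htm_scale_def)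

lemma htm_uminus_scale: "- M = (- 1) *\<^sub>h M"
  by (auto intro!: eq_matI simp: htm_scale_def)

lemma htm_minus_scale:
  "M \<in> carrier_mat a b \<Longrightarrow> M' \<in> carrier_mat a b \<Longrightarrow> M - M' = M + (- 1) *\<^sub>h M'"
  by (auto intro!: eq_matI simp: htm_scale_def)

lemma htm_mult_zero [simp]:
  "L \<in> carrier_mat a b \<Longrightarrow> L \<odot>\<^bsub>t\<^esub> 0\<^sub>m b c = 0\<^sub>m a c"
  "M \<in> carrier_mat b c \<Longrightarrow> 0\<^sub>m a b \<odot>\<^bsub>t\<^esub> M = 0\<^sub>m a c"
  by (auto intro!: eq_matI simp: htm_mult_def)

lemma htm_adj_adj [simp]: "(M\<^sup>\<circledast>)\<^sup>\<circledast> = M"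
  by (intro eq_matI) (auto simp: htm_adj_def ht_conj_def)

lemma htm_adj_one [simp]: "(htm_one N)\<^sup>\<circledast> = htm_one N"
  by (intro eq_matI)
    (auto simp: htm_adj_def htm_one_def ht_conj_def ht_one_def ht_of_complex_def zero_prod_def)

lemma htm_adj_zero [simp]: "(0\<^sub>m a b)\<^sup>\<circledast> = 0\<^sub>m b a"
  by (intro eq_matI) (auto simp: htm_adj_def ht_conj_def zero_prod_def)

lemma htm_adj_add:
  "M \<in> carrier_mat a b \<Longrightarrow> M' \<in> carrier_mat a b \<Longrightarrow> (M + M')\<^sup>\<circledast> = M\<^sup>\<circledast> + M'\<^sup>\<circledast>"
  by (intro eq_matI) (auto simp: htm_adj_def ht_conj_def prod_eq_iff)

lemma htm_adj_scale: "(x *\<^sub>h M)\<^sup>\<circledast> = x *\<^sub>h M\<^sup>\<circledast>"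
  by (intro eq_matI) (auto simp: htm_adj_def htm_scale_def ht_conj_def prod_eq_iff)

lemma ht_conj_sum: "ht_conj (\<Sum>i\<in>S. f i) = (\<Sum>i\<in>S. ht_conj (f i))"
  by (induction S rule: infinite_finite_induct)
    (auto simp: ht_conj_def prod_eq_iff zero_prod_def)

lemma htm_adj_mult:
  assumes "L \<in> carrier_mat a b" "M \<in> carrier_mat b c"
  shows "(L \<odot>\<^bsub>t\<^esub> M)\<^sup>\<circledast> = M\<^sup>\<circledast> \<odot>\<^bsub>t\<^esub> L\<^sup>\<circledast>"
  using assms
  by (intro eq_matI) (auto simp: htm_adj_def htm_mult_def ht_conj_sum ht_conj_mult)

lemma htm_adj_eq_zero_iff:
  assumes "M \<in> carrier_mat a b"
  shows "M\<^sup>\<circledast> = 0\<^sub>m b a \<longleftrightarrow> M = 0\<^sub>m a b"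
  using assms by (metis htm_adj_adj htm_adj_zero)

lemma htm_pow_commute:
  assumes "M \<in> carrier_mat N N"
  shows "htm_pow t M k \<odot>\<^bsub>t\<^esub> M = M \<odot>\<^bsub>t\<^esub> htm_pow t M k"
proof (induction k)
  case (Suc k)
  then show ?case
    using assms htm_assoc[of M N N "htm_pow t M k" N M N] by simp
qed (use assms in auto)

lemma htm_pow_add:
  assumes "M \<in> carrier_mat N N"
  shows "htm_pow t M (j + k) = htm_pow t M j \<odot>\<^bsub>t\<^esub> htm_pow t M k"
proof (induction k)
  case (Suc k)
  then show ?case
    using assms htm_assoc[of "htm_pow t M j" N N "htm_pow t M k" N M N] by simp
qed (use assms htm_one_right[of "htm_pow t M j" N N] in auto)

lemma htm_pow_adj:
  assumes "M \<in> carrier_mat N N"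
  shows "(htm_pow t M k)\<^sup>\<circledast> = htm_pow t (M\<^sup>\<circledast>) k"
proof (induction k)
  case (Suc k)
  have "(htm_pow t M (Suc k))\<^sup>\<circledast> = (M \<odot>\<^bsub>t\<^esub> htm_pow t M k)\<^sup>\<circledast>"
    using assms by (simp add: htm_pow_commute)
  then show ?case
    using assms Suc by (simp add: htm_adj_mult[where a = N and b = N and c = N])
qed (use assms in simp)

lemma htm_pow_uminus:
  assumes "M \<in> carrier_mat N N"
  shows "htm_pow t (- M) k = ((- 1) ^ k) *\<^sub>h htm_pow t M k"
proof (induction k)
  case (Suc k)
  have "htm_pow t (- M) (Suc k) = (((- 1) ^ k) *\<^sub>h htm_pow t M k) \<odot>\<^bsub>t\<^esub> ((- 1) *\<^sub>h M)"
    by (simp only: htm_pow.simps Suc) (simp add: htm_uminus_scale)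
  then show ?case
    using assms
    by (simp add: htm_scale_mult[where a = N and b = N and c = N]
        htm_mult_scale[where a = N and b = N and c = N])
qed (use assms in auto)

lemma htm_inverse_ofD:
  assumes "htm_inverse_of t M K" "M \<in> carrier_mat N N"
  shows "K \<in> carrier_mat N N" "M \<odot>\<^bsub>t\<^esub> K = htm_one N" "K \<odot>\<^bsub>t\<^esub> M = htm_one N" "htm_inv t M = K"
  using assms htm_inv_eqI[OF assms(1)] by (auto simp: htm_inverse_of_def)

lemma htm_inverse_ofI:
  assumes "M \<in> carrier_mat N N" "K \<in> carrier_mat N N"
    "M \<odot>\<^bsub>t\<^esub> K = htm_one N" "K \<odot>\<^bsub>t\<^esub> M = htm_one N"
  shows "htm_inverse_of t M K"
  using assms by (auto simp: htm_inverse_of_def)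

lemma htm_inv_inverse_of:
  assumes "htm_invertible t M"
  shows "htm_inverse_of t M (htm_inv t M)"
  using assms htm_inv_eqI by (fastforce simp: htm_invertible_def)

lemma htm_inverse_of_adj:
  assumes "htm_inverse_of t M K" "M \<in> carrier_mat N N"
  shows "htm_inverse_of t (M\<^sup>\<circledast>) (K\<^sup>\<circledast>)"
proof (rule htm_inverse_ofI)
  note K = htm_inverse_ofD[OF assms]
  show "M\<^sup>\<circledast> \<odot>\<^bsub>t\<^esub> K\<^sup>\<circledast> = htm_one N" "K\<^sup>\<circledast> \<odot>\<^bsub>t\<^esub> M\<^sup>\<circledast> = htm_one N"
    using assms K by (simp_all add: htm_adj_mult[where a = N and b = N and c = N, symmetric])
qed (use assms htm_inverse_ofD[OF assms] in auto)

text \<open>An \<open>N \<times> 1\<close> matrix rather than a vector, because the product over \<open>H\<^sub>t\<close> acts on matrices.\<close>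

definition htm_col :: "ht mat \<Rightarrow> nat \<Rightarrow> ht mat" where
  "htm_col M j = mat (dim_row M) 1 (\<lambda>(i, _). M $$ (i, j))"

lemma htm_col_carrier [simp]: "M \<in> carrier_mat a b \<Longrightarrow> htm_col M j \<in> carrier_mat a 1"
  by (auto simp: htm_col_def)

lemma htm_mult_col:
  assumes "L \<in> carrier_mat a b" "M \<in> carrier_mat b c" "j < c"
  shows "L \<odot>\<^bsub>t\<^esub> htm_col M j = htm_col (L \<odot>\<^bsub>t\<^esub> M) j"
  using assms by (intro eq_matI) (auto simp: htm_mult_def htm_col_def)

lemma htm_eq_cols:
  assumes "L \<in> carrier_mat a b" "M \<in> carrier_mat a b" "\<And>j. j < b \<Longrightarrow> htm_col L j = htm_col M j"
  shows "L = M"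
proof (rule eq_matI)
  fix i j assume "i < dim_row M" "j < dim_col M"
  then have "htm_col L j $$ (i, 0) = htm_col M j $$ (i, 0)" using assms by auto
  then show "L $$ (i, j) = M $$ (i, j)"
    using \<open>i < dim_row M\<close> assms by (auto simp: htm_col_def)
qed (use assms in auto)

lemma htm_exists_cols:
  assumes "\<And>j. j < b \<Longrightarrow> \<exists>u\<in>carrier_mat a 1. P j u"
  shows "\<exists>M\<in>carrier_mat a b. \<forall>j<b. P j (htm_col M j)"
proof -
  obtain u where u: "\<And>j. j < b \<Longrightarrow> u j \<in> carrier_mat a 1 \<and> P j (u j)"
    using assms by metis
  define M where "M = mat a b (\<lambda>(i, j). u j $$ (i, 0))"
  have "htm_col M j = u j" if "j < b" for j
    using u[OF that] that by (intro eq_matI) (auto simp: M_def htm_col_def)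
  then show ?thesis using u by (intro bexI[of _ M]) (auto simp: M_def)
qed

section \<open>Spanning by controllability\<close>

text \<open>
  \<open>(p, q) \<mapsto> Re (fst (p q))\<close> is half the reduced trace form of \<open>H\<^sub>t\<close>. Over the real basis \<open>1, i, j, i j\<close> its
  matrix is diagonal with entries \<open>1, -1, t, t\<close>, so for \<open>t \<noteq> 0\<close> every
  real-linear functional is represented by it. This duality replaces division, which fails in \<open>H\<^sub>t\<close> for
  \<open>t > 0\<close>.
\<close>

lemma ht_functional_trace_form:
  assumes "t \<noteq> 0" "\<And>p q. g (p + q) = g p + g q" "\<And>c p. g (c *\<^sub>R p) = c * g p"
  shows "\<exists>p. \<forall>q::ht. g q = Re (fst (p \<cdot>\<^bsub>t\<^esub> q))"
proof -
  define p :: ht where "p = (Complex (g (1, 0)) (- g (\<i>, 0)),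
    Complex (g (0, 1) / t) (g (0, \<i>) / t))"
  have "g q = Re (fst (p \<cdot>\<^bsub>t\<^esub> q))" for q
  proof -
    have "q = Re (fst q) *\<^sub>R (1, 0) + (Im (fst q) *\<^sub>R (\<i>, 0)
        + (Re (snd q) *\<^sub>R (0, 1) + Im (snd q) *\<^sub>R (0, \<i>)))"
      by (auto simp: prod_eq_iff complex_eq_iff)
    then have "g q = Re (fst q) * g (1, 0) + (Im (fst q) * g (\<i>, 0)
        + (Re (snd q) * g (0, 1) + Im (snd q) * g (0, \<i>)))"
      by (metis assms(2,3))
    also have "\<dots> = Re (fst (p \<cdot>\<^bsub>t\<^esub> q))"
      using \<open>t \<noteq> 0\<close> by (simp add: p_def ht_mult_def field_simps)
    finally show ?thesis .
  qed
  then show ?thesis by blast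
qed

lemma ht_trace_form_nondegenerate:
  assumes "t \<noteq> 0" "\<And>q. Re (fst (p \<cdot>\<^bsub>t\<^esub> q)) = 0"
  shows "p = 0"
  using assms(1) assms(2)[of "(1, 0)"] assms(2)[of "(\<i>, 0)"]
    assms(2)[of "(0, 1)"] assms(2)[of "(0, \<i>)"]
  by (auto simp: ht_mult_def prod_eq_iff complex_eq_iff)

text \<open>
  A vector outside a real subspace is separated from it by a real-linear functional, and each such
  functional on columns is the trace form against a row. The functional comes from extending a basis of
  the subspace, which is done in the real vector space of all sequences: there the subspace becomes its
  preimage \<open>V\<close> under truncation to the first \<open>N\<close> entries.
\<close>

lemma subspace_of_columns_eq_carrier:
  assumes "t \<noteq> 0" and W: "W \<subseteq> carrier_mat N 1" "0\<^sub>m N 1 \<in> W"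
    and add: "\<And>v w. v \<in> W \<Longrightarrow> w \<in> W \<Longrightarrow> v + w \<in> W"
    and scale: "\<And>c v. v \<in> W \<Longrightarrow> c *\<^sub>h v \<in> W"
    and annihilator: "\<And>h. h \<in> carrier_mat 1 N \<Longrightarrow>
      (\<And>w. w \<in> W \<Longrightarrow> Re (fst ((h \<odot>\<^bsub>t\<^esub> w) $$ (0, 0))) = 0) \<Longrightarrow> h = 0\<^sub>m 1 N"
  shows "W = carrier_mat N 1"
proof (rule ccontr)
  assume "W \<noteq> carrier_mat N 1"
  then obtain w0 where w0: "w0 \<in> carrier_mat N 1" "w0 \<notin> W" using W by blast
  define s where "s = (\<lambda>(c::real) (v::nat \<Rightarrow> ht). (\<lambda>i. c *\<^sub>R v i))"
  define col where "col = (\<lambda>v::nat \<Rightarrow> ht. mat N 1 (\<lambda>(i, _). v i))"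
  define V where "V = {v. col v \<in> W}"
  interpret vector_space_pair s "(*) :: real \<Rightarrow> real \<Rightarrow> real"
    by unfold_locales (auto simp: s_def fun_eq_iff algebra_simps)
  have col_add: "col (v + w) = col v + col w" for v w
    by (intro eq_matI) (auto simp: col_def)
  have col_s: "col (s c v) = c *\<^sub>h col v" for c v
    by (intro eq_matI) (auto simp: col_def s_def htm_scale_def)
  have col_0: "col v = 0\<^sub>m N 1" if "\<And>i. i < N \<Longrightarrow> v i = 0" for v
    using that by (intro eq_matI) (auto simp: col_def)
  have V: "vs1.subspace V"
    using W add scale col_0[of 0] by (auto simp: vs1.subspace_def V_def col_add col_s)
  define v0 where "v0 = (\<lambda>i. w0 $$ (i, 0))"
  have "col v0 = w0"
    using w0 by (intro eq_matI) (auto simp: col_def v0_def)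
  then have "v0 \<notin> V" using w0 by (simp add: V_def)
  obtain E where E: "E \<subseteq> V" "vs1.independent E" "V \<subseteq> vs1.span E"
    using vs1.maximal_independent_subset by blast
  \<comment> \<open>The functional \<open>f\<close> vanishes on \<open>V\<close> but not at \<open>v0\<close>.\<close>
  have "vs1.span E = V" using E V by (simp add: vs1.span_minimal subset_antisym)
  then have "vs1.independent (insert v0 E)"
    using E \<open>v0 \<notin> V\<close> by (metis vs1.independent_insertI)
  then obtain f where f: "Vector_Spaces.linear s (*) f" "\<forall>v\<in>insert v0 E. f v = (if v = v0 then 1 else 0)"
    using linear_independent_extend[where f = "\<lambda>v. if v = v0 then 1 else 0"] by blast
  have "f v = 0" if "v \<in> E" for v using f(2) that E \<open>v0 \<notin> V\<close> by auto
  then have f_V: "f v = 0" if "v \<in> V" for v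
    using linear_eq_0_on_span[OF f(1)] that \<open>vs1.span E = V\<close> by blast
  define single where "single = (\<lambda>i (q::ht) k. if k = (i::nat) then q else 0)"
  have "\<exists>p. \<forall>q. f (single i q) = Re (fst (p \<cdot>\<^bsub>t\<^esub> q))" for i
  proof (rule ht_functional_trace_form[OF \<open>t \<noteq> 0\<close>])
    fix p q c
    have "single i (p + q) = single i p + single i q" "single i (c *\<^sub>R p) = s c (single i p)"
      by (auto simp: single_def s_def fun_eq_iff)
    then show "f (single i (p + q)) = f (single i p) + f (single i q)"
      "f (single i (c *\<^sub>R p)) = c * f (single i p)"
      by (simp_all add: linear_add[OF f(1)] linear_scale[OF f(1)])
  qed
  then obtain p where p: "\<And>i q. f (single i q) = Re (fst (p i \<cdot>\<^bsub>t\<^esub> q))" by metis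
  define h where "h = mat 1 N (\<lambda>(_, i). p i)"
  have f_eq: "f v = Re (fst ((h \<odot>\<^bsub>t\<^esub> col v) $$ (0, 0)))" for v
  proof -
    have "(\<Sum>i<N. single i (v i)) k = (if k < N then v k else 0)" for k
    proof -
      have "(\<Sum>i\<in>S. single i (v i)) k = (\<Sum>i\<in>S. single i (v i) k)" for S
        by (induction S rule: infinite_finite_induct) auto
      then show ?thesis by (simp add: single_def)
    qed
    then have "v - (\<Sum>i<N. single i (v i)) \<in> V"
      using col_0[of "v - (\<Sum>i<N. single i (v i))"] W by (simp add: V_def)
    then have "f v = f (\<Sum>i<N. single i (v i))"
      using f_V linear_diff[OF f(1)] by (metis eq_iff_diff_eq_0)
    also have "\<dots> = (\<Sum>i<N. Re (fst (p i \<cdot>\<^bsub>t\<^esub> v i)))"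
      by (simp add: linear_sum[OF f(1)] p)
    also have "\<dots> = Re (fst ((h \<odot>\<^bsub>t\<^esub> col v) $$ (0, 0)))"
      by (simp add: h_def col_def htm_mult_def fst_sum)
    finally show ?thesis .
  qed
  have "h = 0\<^sub>m 1 N"
  proof (rule annihilator)
    fix w assume w: "w \<in> W"
    then have "col (\<lambda>i. w $$ (i, 0)) = w"
      using W by (intro eq_matI) (auto simp: col_def)
    then show "Re (fst ((h \<odot>\<^bsub>t\<^esub> w) $$ (0, 0))) = 0"
      using f_eq f_V w by (metis (mono_tags, lifting) V_def mem_Collect_eq)
  qed (simp add: h_def)
  then have "f v0 = 0"
    using f_eq[of v0] W(1) w0 \<open>col v0 = w0\<close> by simp
  then show False using f(2) by auto
qed

text \<open>
  A row annihilating \<open>W\<close> under the trace form annihilates each \<open>A\<^sup>k B w\<close>; as \<open>w\<close> runs over all columns,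
  nondegeneracy gives \<open>h A\<^sup>k B = 0\<close>. Controllability thereby takes the form that the columns
  \<open>A\<^sup>k B w\<close> span the state space over the reals.
\<close>

lemma controllable_columns_span:
  assumes "t \<noteq> 0" "A \<in> carrier_mat N N" "B \<in> carrier_mat N n" "ht_controllable t n N A B"
    and W: "W \<subseteq> carrier_mat N 1" "0\<^sub>m N 1 \<in> W"
    and add: "\<And>v w. v \<in> W \<Longrightarrow> w \<in> W \<Longrightarrow> v + w \<in> W"
    and scale: "\<And>c v. v \<in> W \<Longrightarrow> c *\<^sub>h v \<in> W"
    and reach: "\<And>k w. w \<in> carrier_mat n 1 \<Longrightarrow> htm_pow t A k \<odot>\<^bsub>t\<^esub> (B \<odot>\<^bsub>t\<^esub> w) \<in> W"
  shows "W = carrier_mat N 1"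
proof (rule subspace_of_columns_eq_carrier[OF \<open>t \<noteq> 0\<close> W add scale])
  fix h assume h: "h \<in> carrier_mat 1 N"
    and h0: "\<And>w. w \<in> W \<Longrightarrow> Re (fst ((h \<odot>\<^bsub>t\<^esub> w) $$ (0, 0))) = 0"
  have "h \<odot>\<^bsub>t\<^esub> htm_pow t A k \<odot>\<^bsub>t\<^esub> B = 0\<^sub>m 1 n" for k
  proof (rule eq_matI)
    let ?r = "h \<odot>\<^bsub>t\<^esub> htm_pow t A k \<odot>\<^bsub>t\<^esub> B"
    have r: "?r \<in> carrier_mat 1 n" using h assms by (meson htm_mult_carrier htm_pow_carrier)
    fix i j assume "i < dim_row (0\<^sub>m 1 n :: ht mat)" "j < dim_col (0\<^sub>m 1 n :: ht mat)"
    then have ij: "i = 0" "j < n" by auto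
    have "?r $$ (0, j) = 0"
    proof (rule ht_trace_form_nondegenerate[OF \<open>t \<noteq> 0\<close>])
      fix q
      \<comment> \<open>The column \<open>w\<close> with the single entry \<open>q\<close> at \<open>j\<close> isolates the \<open>j\<close>-th entry of the row.\<close>
      define w :: "ht mat" where "w = mat n 1 (\<lambda>(l, _). if l = j then q else 0)"
      have w: "w \<in> carrier_mat n 1" by (simp add: w_def)
      have "?r \<odot>\<^bsub>t\<^esub> w = h \<odot>\<^bsub>t\<^esub> (htm_pow t A k \<odot>\<^bsub>t\<^esub> (B \<odot>\<^bsub>t\<^esub> w))"
        using h w assms(2,3)
        by (smt (verit) htm_assoc htm_mult_carrier htm_pow_carrier)
      then have "Re (fst ((?r \<odot>\<^bsub>t\<^esub> w) $$ (0, 0))) = 0"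
        using h0[OF reach[OF w]] by simp
      moreover have "(?r \<odot>\<^bsub>t\<^esub> w) $$ (0, 0) = ?r $$ (0, j) \<cdot>\<^bsub>t\<^esub> q"
        using ij htm_index_mult[OF r w, of 0 0]
        by (simp add: w_def if_distrib[of "\<lambda>p. _ \<cdot>\<^bsub>t\<^esub> p"] cong: if_cong)
      ultimately show "Re (fst (?r $$ (0, j) \<cdot>\<^bsub>t\<^esub> q)) = 0" by simp
    qed
    then show "?r $$ (i, j) = 0\<^sub>m 1 n $$ (i, j)" using ij by simp
  qed (use h assms in \<open>auto simp: htm_mult_def\<close>)
  then show "h = 0\<^sub>m 1 N" using \<open>ht_controllable t n N A B\<close> h by (auto simp: ht_controllable_def)
qed

section \<open>Power series of the resolvent\<close>

lemma ht_norm_mult: "norm (p \<cdot>\<^bsub>t\<^esub> q) \<le> (3 + \<bar>t\<bar>) * (norm p * norm q)"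
proof -
  have *: "norm u * norm v \<le> norm p * norm q"
    if "u = fst p \<or> u = snd p" "v = fst q \<or> v = snd q" for u v
    using that norm_fst_le[of "fst p" "snd p"] norm_snd_le[of "snd p" "fst p"]
      norm_fst_le[of "fst q" "snd q"] norm_snd_le[of "snd q" "fst q"]
    by (auto intro!: mult_mono)
  have "norm (p \<cdot>\<^bsub>t\<^esub> q) \<le> norm (fst (p \<cdot>\<^bsub>t\<^esub> q)) + norm (snd (p \<cdot>\<^bsub>t\<^esub> q))"
    by (metis norm_Pair_le prod.collapse)
  also have "\<dots> \<le> (norm (fst p * fst q) + norm (of_real t * snd p * cnj (snd q)))
      + (norm (fst p * snd q) + norm (snd p * cnj (fst q)))"
    unfolding ht_mult_def by (auto intro!: add_mono norm_triangle_ineq)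
  also have "\<dots> = norm (fst p) * norm (fst q) + \<bar>t\<bar> * (norm (snd p) * norm (snd q))
      + (norm (fst p) * norm (snd q) + norm (snd p) * norm (fst q))"
    by (simp add: norm_mult)
  also have "\<dots> \<le> norm p * norm q + \<bar>t\<bar> * (norm p * norm q) + (norm p * norm q + norm p * norm q)"
    by (intro add_mono mult_left_mono *) auto
  finally show ?thesis by (simp add: algebra_simps)
qed

lemma htm_entries_bounded:
  assumes "M \<in> carrier_mat a b"
  shows "\<exists>c\<ge>0. \<forall>i<a. \<forall>j<b. norm (M $$ (i, j)) \<le> c"
proof (intro exI conjI allI impI)
  let ?c = "\<Sum>p\<in>{..<a} \<times> {..<b}. norm (M $$ p)"
  show "0 \<le> ?c" by (simp add: sum_nonneg)
  show "norm (M $$ (i, j)) \<le> ?c" if "i < a" "j < b" for i j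
    using that by (intro member_le_sum) auto
qed

lemma htm_entries_mult_le:
  assumes "L \<in> carrier_mat a b" "M \<in> carrier_mat b c" "0 \<le> l"
    and "\<forall>i<a. \<forall>j<b. norm (L $$ (i, j)) \<le> l" "\<forall>i<b. \<forall>j<c. norm (M $$ (i, j)) \<le> m"
    and "i < a" "j < c"
  shows "norm ((L \<odot>\<^bsub>t\<^esub> M) $$ (i, j)) \<le> real b * ((3 + \<bar>t\<bar>) * (l * m))"
proof -
  have "norm ((L \<odot>\<^bsub>t\<^esub> M) $$ (i, j)) \<le> (\<Sum>k<b. norm (L $$ (i, k) \<cdot>\<^bsub>t\<^esub> M $$ (k, j)))"
    using assms by (simp add: htm_index_mult norm_sum)
  also have "\<dots> \<le> (\<Sum>k<b. (3 + \<bar>t\<bar>) * (l * m))"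
    using assms by (intro sum_mono order_trans[OF ht_norm_mult] mult_left_mono mult_mono) auto
  finally show ?thesis by simp
qed

text \<open>
  A crude submultiplicative estimate suffices: it only has to make the radius of convergence of the
  Neumann series positive. The added \<open>1\<close> in \<open>\<rho>\<close> keeps it positive when \<open>A = 0\<close> or \<open>N = 0\<close>.
\<close>

lemma htm_pow_entries_le:
  assumes A: "A \<in> carrier_mat N N"
  shows "\<exists>\<rho>>0. \<forall>k. \<forall>i<N. \<forall>j<N. norm (htm_pow t A k $$ (i, j)) \<le> \<rho> ^ k"
proof -
  obtain c where c: "c \<ge> 0" "\<forall>i<N. \<forall>j<N. norm (A $$ (i, j)) \<le> c"
    using htm_entries_bounded[OF A] by blast
  define \<rho> where "\<rho> = real N * ((3 + \<bar>t\<bar>) * c) + 1"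
  have "\<rho> > 0" using c by (simp add: \<rho>_def add_nonneg_pos)
  have "\<forall>i<N. \<forall>j<N. norm (htm_pow t A k $$ (i, j)) \<le> \<rho> ^ k" for k
  proof (induction k)
    case 0
    show ?case
      using A by (auto simp: htm_one_def ht_one_def ht_of_complex_def norm_Pair)
  next
    case (Suc k)
    show ?case
    proof (intro allI impI)
      fix i j assume "i < N" "j < N"
      then have "norm (htm_pow t A (Suc k) $$ (i, j)) \<le> real N * ((3 + \<bar>t\<bar>) * (\<rho> ^ k * c))"
        using htm_entries_mult_le[OF _ A _ Suc c(2), of i j t] A \<open>\<rho> > 0\<close> by simp
      also have "\<dots> \<le> \<rho> ^ Suc k" using \<open>\<rho> > 0\<close> by (simp add: \<rho>_def algebra_simps)
      finally show "norm (htm_pow t A (Suc k) $$ (i, j)) \<le> \<rho> ^ Suc k" .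
    qed
  qed
  then show ?thesis using \<open>\<rho> > 0\<close> by blast
qed

lemma resolvent_step:
  assumes A: "A \<in> carrier_mat N N" and R: "R \<in> carrier_mat N N"
    and inv: "(htm_one N - x *\<^sub>h A) \<odot>\<^bsub>t\<^esub> R = htm_one N"
  shows "htm_pow t A k \<odot>\<^bsub>t\<^esub> R = htm_pow t A k + x *\<^sub>h (htm_pow t A (Suc k) \<odot>\<^bsub>t\<^esub> R)"
proof -
  let ?P = "htm_pow t A k"
  have P: "?P \<in> carrier_mat N N" using A by simp
  have Q: "?P \<odot>\<^bsub>t\<^esub> A \<odot>\<^bsub>t\<^esub> R \<in> carrier_mat N N"
    using htm_mult_carrier[OF htm_mult_carrier[OF P A] R] .
  have "?P = ?P \<odot>\<^bsub>t\<^esub> (R + (- x) *\<^sub>h (A \<odot>\<^bsub>t\<^esub> R))"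
    using inv A R P
    by (simp add: htm_minus_scale[where a = N and b = N] htm_add_mult[where a = N and b = N and c = N]
        htm_scale_mult[where a = N and b = N and c = N] htm_one_right[of ?P N N])
  also have "\<dots> = ?P \<odot>\<^bsub>t\<^esub> R + (- x) *\<^sub>h (?P \<odot>\<^bsub>t\<^esub> A \<odot>\<^bsub>t\<^esub> R)"
    using A R P Q
    by (simp add: htm_mult_add[where a = N and b = N and c = N]
        htm_mult_scale[where a = N and b = N and c = N] htm_assoc[where a = N and b = N and c = N and d = N])
  finally have *: "?P = ?P \<odot>\<^bsub>t\<^esub> R + (- x) *\<^sub>h (?P \<odot>\<^bsub>t\<^esub> A \<odot>\<^bsub>t\<^esub> R)" .
  have "?P \<odot>\<^bsub>t\<^esub> R = (?P \<odot>\<^bsub>t\<^esub> R + (- x) *\<^sub>h (?P \<odot>\<^bsub>t\<^esub> A \<odot>\<^bsub>t\<^esub> R)) + x *\<^sub>h (?P \<odot>\<^bsub>t\<^esub> A \<odot>\<^bsub>t\<^esub> R)"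
    using A R P by (intro eq_matI) (auto simp: htm_scale_def htm_mult_def)
  with * show ?thesis by simp
qed

text \<open>
  Entrywise Neumann series. Iterating the step above from \<open>k = 0\<close> shows that the \<open>K\<close>-th partial sum misses
  the limit by \<open>x\<^sup>K\<close> times the same entry with \<open>A\<^sup>K R\<close> in place of \<open>R\<close>, and this remainder tends to \<open>0\<close> when
  \<open>\<bar>x\<bar> \<rho> < 1\<close>. The remainder is estimated at a fixed \<open>x\<close>, so
  \<open>R\<close> may be any right inverse at that point; the radius depends on \<open>A\<close> alone, so it serves all \<open>L\<close>
  and \<open>X\<close>.
\<close>

lemma resolvent_sums:
  assumes A: "A \<in> carrier_mat N N"
  obtains r where "r > 0"
    "\<And>x a b R L X i j. \<bar>x\<bar> < r \<Longrightarrow> R \<in> carrier_mat N N \<Longrightarrow>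
      (htm_one N - x *\<^sub>h A) \<odot>\<^bsub>t\<^esub> R = htm_one N \<Longrightarrow>
      L \<in> carrier_mat a N \<Longrightarrow> X \<in> carrier_mat N b \<Longrightarrow> i < a \<Longrightarrow> j < b \<Longrightarrow>
      (\<lambda>k. x ^ k *\<^sub>R ((L \<odot>\<^bsub>t\<^esub> htm_pow t A k \<odot>\<^bsub>t\<^esub> X) $$ (i, j))) sums ((L \<odot>\<^bsub>t\<^esub> R \<odot>\<^bsub>t\<^esub> X) $$ (i, j))"
proof -
  obtain \<rho> where \<rho>: "\<rho> > 0" "\<And>k. \<forall>i<N. \<forall>j<N. norm (htm_pow t A k $$ (i, j)) \<le> \<rho> ^ k"
    using htm_pow_entries_le[OF A] by blast
  have "(\<lambda>k. x ^ k *\<^sub>R ((L \<odot>\<^bsub>t\<^esub> htm_pow t A k \<odot>\<^bsub>t\<^esub> X) $$ (i, j))) sums ((L \<odot>\<^bsub>t\<^esub> R \<odot>\<^bsub>t\<^esub> X) $$ (i, j))"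
    if x: "\<bar>x\<bar> < 1 / \<rho>" and R: "R \<in> carrier_mat N N"
      and inv: "(htm_one N - x *\<^sub>h A) \<odot>\<^bsub>t\<^esub> R = htm_one N"
      and L: "L \<in> carrier_mat a N" and X: "X \<in> carrier_mat N b" and ij: "i < a" "j < b"
    for x a b R L X i j
  proof -
    define c where "c = (\<lambda>k. (L \<odot>\<^bsub>t\<^esub> htm_pow t A k \<odot>\<^bsub>t\<^esub> X) $$ (i, j))"
    define s where "s = (\<lambda>k. (L \<odot>\<^bsub>t\<^esub> (htm_pow t A k \<odot>\<^bsub>t\<^esub> R) \<odot>\<^bsub>t\<^esub> X) $$ (i, j))"
    have step: "s k = c k + x *\<^sub>R s (Suc k)" for k
    proof -
      let ?P = "htm_pow t A k" and ?Q = "htm_pow t A (Suc k) \<odot>\<^bsub>t\<^esub> R"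
      have P: "?P \<in> carrier_mat N N" using A by simp
      have Q: "?Q \<in> carrier_mat N N" by (rule htm_mult_carrier[OF htm_pow_carrier[OF A] R])
      have "L \<odot>\<^bsub>t\<^esub> (?P \<odot>\<^bsub>t\<^esub> R) \<odot>\<^bsub>t\<^esub> X = L \<odot>\<^bsub>t\<^esub> (?P + x *\<^sub>h ?Q) \<odot>\<^bsub>t\<^esub> X"
        by (subst resolvent_step[OF A R inv]) (rule refl)
      also have "\<dots> = (L \<odot>\<^bsub>t\<^esub> ?P + x *\<^sub>h (L \<odot>\<^bsub>t\<^esub> ?Q)) \<odot>\<^bsub>t\<^esub> X"
        using htm_mult_add[OF L P, of "x *\<^sub>h ?Q" t] htm_mult_scale[OF L Q, of t x] Q by simp
      also have "\<dots> = L \<odot>\<^bsub>t\<^esub> ?P \<odot>\<^bsub>t\<^esub> X + x *\<^sub>h (L \<odot>\<^bsub>t\<^esub> ?Q \<odot>\<^bsub>t\<^esub> X)"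
        using htm_add_mult[of "L \<odot>\<^bsub>t\<^esub> ?P" a N "x *\<^sub>h (L \<odot>\<^bsub>t\<^esub> ?Q)" X b t]
          htm_scale_mult[of "L \<odot>\<^bsub>t\<^esub> ?Q" a N X b x t] L P Q X by simp
      finally show ?thesis
        using L P Q X ij unfolding s_def c_def
        by (simp del: htm_pow.simps add: htm_scale_def htm_mult_def)
    qed
    have partial: "(\<Sum>k<K. x ^ k *\<^sub>R c k) = s 0 - x ^ K *\<^sub>R s K" for K
    proof (induction K)
      case (Suc K)
      then show ?case by (simp add: step[of K] scaleR_add_right mult.commute)
    qed simp
    obtain l where l: "l \<ge> 0" "\<forall>i<a. \<forall>j<N. norm (L $$ (i, j)) \<le> l"
      using htm_entries_bounded[OF L] by blast
    have RX: "R \<odot>\<^bsub>t\<^esub> X \<in> carrier_mat N b" using R X by simp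
    obtain m where m: "m \<ge> 0" "\<forall>i<N. \<forall>j<b. norm ((R \<odot>\<^bsub>t\<^esub> X) $$ (i, j)) \<le> m"
      using htm_entries_bounded[OF RX] by blast
    define M where "M = real N * ((3 + \<bar>t\<bar>) * (real N * ((3 + \<bar>t\<bar>) * l) * m))"
    have s_le: "norm (s k) \<le> M * \<rho> ^ k" for k
    proof -
      let ?P = "htm_pow t A k"
      have P: "?P \<in> carrier_mat N N" using A by simp
      have LP: "L \<odot>\<^bsub>t\<^esub> ?P \<in> carrier_mat a N" using L P by simp
      have "L \<odot>\<^bsub>t\<^esub> (?P \<odot>\<^bsub>t\<^esub> R) \<odot>\<^bsub>t\<^esub> X = L \<odot>\<^bsub>t\<^esub> ?P \<odot>\<^bsub>t\<^esub> (R \<odot>\<^bsub>t\<^esub> X)"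
        using htm_assoc[OF L P R, of t] htm_assoc[OF LP R X, of t] by simp
      moreover have "\<forall>i<a. \<forall>j<N. norm ((L \<odot>\<^bsub>t\<^esub> ?P) $$ (i, j)) \<le> real N * ((3 + \<bar>t\<bar>) * (l * \<rho> ^ k))"
        using htm_entries_mult_le[OF L P l \<rho>(2)] by blast
      ultimately have "norm (s k) \<le> real N * ((3 + \<bar>t\<bar>) * (real N * ((3 + \<bar>t\<bar>) * (l * \<rho> ^ k)) * m))"
        unfolding s_def using htm_entries_mult_le[OF LP RX _ _ m(2) ij] l \<rho>(1) by simp
      then show ?thesis by (simp add: M_def algebra_simps)
    qed
    have lim: "(\<lambda>K. M * (\<bar>x\<bar> * \<rho>) ^ K) \<longlonglongrightarrow> 0"
      using x \<rho>(1) by (intro tendsto_mult_right_zero LIMSEQ_realpow_zero) (auto simp: field_simps)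
    have le: "norm (x ^ K *\<^sub>R s K) \<le> norm (M * (\<bar>x\<bar> * \<rho>) ^ K) * 1" for K
    proof -
      have "norm (x ^ K *\<^sub>R s K) \<le> M * (\<bar>x\<bar> * \<rho>) ^ K"
        using mult_left_mono[OF s_le[of K], of "\<bar>x\<bar> ^ K"]
        by (simp add: power_abs power_mult_distrib algebra_simps)
      also have "\<dots> \<le> norm (M * (\<bar>x\<bar> * \<rho>) ^ K)"
        unfolding real_norm_def by (rule abs_ge_self)
      finally show ?thesis by (simp only: mult_1_right)
    qed
    have "(\<lambda>K. x ^ K *\<^sub>R s K) \<longlonglongrightarrow> 0"
      by (rule tendsto_0_le[OF lim always_eventually[OF allI[OF le]]])
    then have "(\<lambda>K. \<Sum>k<K. x ^ k *\<^sub>R c k) \<longlonglongrightarrow> s 0 - 0"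
      unfolding partial by (intro tendsto_diff tendsto_const)
    then show ?thesis using A R by (simp add: sums_def c_def s_def)
  qed
  then show thesis using \<rho>(1) by (intro that[of "1 / \<rho>"]) auto
qed

text \<open>
  The punctured neighbourhood matters: the difference of two realizations gives information on the
  resolvents only after dividing by \<open>x\<close>. If the coefficients below \<open>m\<close> vanish, dividing by \<open>x\<^sup>m\<close> and
  letting \<open>x\<close> tend to \<open>0\<close> exposes the coefficient \<open>m\<close>.
\<close>

lemma power_series_zero_real:
  fixes d :: "nat \<Rightarrow> real"
  assumes "r > 0" "\<And>x. x \<noteq> 0 \<Longrightarrow> \<bar>x\<bar> < r \<Longrightarrow> (\<lambda>k. d k * x ^ k) sums 0"
  shows "d m = 0"
proof (induction m rule: less_induct)
  case (less m)
  have "(\<lambda>k. d (k + m) * x ^ k) sums 0" if "x \<noteq> 0" "norm x < r" for x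
  proof -
    have "(\<lambda>k. d (k + m) * x ^ (k + m)) sums 0"
      using assms(2)[of x] that less by (subst sums_iff_shift) auto
    then have "(\<lambda>k. d (k + m) * x ^ (k + m) / x ^ m) sums (0 / x ^ m)" by (rule sums_divide)
    then show ?thesis using that by (simp add: power_add)
  qed
  then have "((\<lambda>x::real. 0::real) \<longlongrightarrow> d (0 + m)) (at 0)"
    by (rule powser_limit_0_strong[OF \<open>r > 0\<close>])
  then show ?case by (metis LIM_unique tendsto_const add_0)
qed

lemma ht_power_series_zero:
  fixes c :: "nat \<Rightarrow> ht"
  assumes "r > 0" "\<And>x. x \<noteq> 0 \<Longrightarrow> \<bar>x\<bar> < r \<Longrightarrow> (\<lambda>k. x ^ k *\<^sub>R c k) sums 0"
  shows "c m = 0"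
proof -
  have *: "f (c m) = 0" if f: "bounded_linear f" for f :: "ht \<Rightarrow> real"
  proof (rule power_series_zero_real[OF \<open>r > 0\<close>])
    fix x :: real assume "x \<noteq> 0" "\<bar>x\<bar> < r"
    then show "(\<lambda>k. f (c k) * x ^ k) sums 0"
      using bounded_linear.sums[OF f assms(2), of x]
      by (simp add: linear_scale[OF bounded_linear.linear[OF f]]
          linear_0[OF bounded_linear.linear[OF f]] mult.commute)
  qed
  note compose = bounded_linear_compose
  show ?thesis
    using *[OF compose[OF bounded_linear_Re bounded_linear_fst]]
      *[OF compose[OF bounded_linear_Im bounded_linear_fst]]
      *[OF compose[OF bounded_linear_Re bounded_linear_snd]]
      *[OF compose[OF bounded_linear_Im bounded_linear_snd]]
    by (auto simp: prod_eq_iff complex_eq_iff)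
qed

section \<open>Observability through Markov parameters\<close>

text \<open>
  Observability in terms of powers of \<open>A\<close>, the exact mirror image of controllability.
\<close>

definition ht_kalman_observable :: "real \<Rightarrow> nat \<Rightarrow> nat \<Rightarrow> ht mat \<Rightarrow> ht mat \<Rightarrow> bool" where
  "ht_kalman_observable t n N C A \<longleftrightarrow>
     (\<forall>h\<in>carrier_mat N 1. (\<forall>k. C \<odot>\<^bsub>t\<^esub> htm_pow t A k \<odot>\<^bsub>t\<^esub> h = 0\<^sub>m n 1) \<longrightarrow> h = 0\<^sub>m N 1)"

text \<open>
  Observability tests matrices column by column; this is the uniqueness principle behind
  \<open>S T = 1\<close>, \<open>S A = A' S\<close>, \<open>S B = B'\<close> and \<open>H = H\<^sup>\<circledast>\<close> below.
\<close>

lemma kalman_observable_cancel: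
  assumes "ht_kalman_observable t n N C A" and C: "C \<in> carrier_mat n N" and A: "A \<in> carrier_mat N N"
    and X: "X \<in> carrier_mat N p" and Y: "Y \<in> carrier_mat N p"
    and eq: "\<And>k. C \<odot>\<^bsub>t\<^esub> htm_pow t A k \<odot>\<^bsub>t\<^esub> X = C \<odot>\<^bsub>t\<^esub> htm_pow t A k \<odot>\<^bsub>t\<^esub> Y"
  shows "X = Y"
proof (rule htm_eq_cols[OF X Y])
  fix j assume j: "j < p"
  let ?x = "htm_col X j" and ?y = "htm_col Y j"
  have xy: "?x \<in> carrier_mat N 1" "?y \<in> carrier_mat N 1" using htm_col_carrier[OF X] htm_col_carrier[OF Y] by auto
  have "C \<odot>\<^bsub>t\<^esub> htm_pow t A k \<odot>\<^bsub>t\<^esub> (?x + (- 1) *\<^sub>h ?y) = 0\<^sub>m n 1" for k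
  proof -
    let ?L = "C \<odot>\<^bsub>t\<^esub> htm_pow t A k"
    have L: "?L \<in> carrier_mat n N" using A C by simp
    have "?L \<odot>\<^bsub>t\<^esub> (?x + (- 1) *\<^sub>h ?y) = ?L \<odot>\<^bsub>t\<^esub> ?x + (- 1) *\<^sub>h (?L \<odot>\<^bsub>t\<^esub> ?y)"
      using htm_mult_add[OF L xy(1), of "(- 1) *\<^sub>h ?y" t] htm_mult_scale[OF L xy(2), of t "- 1"] xy
      by simp
    also have "?L \<odot>\<^bsub>t\<^esub> ?x = ?L \<odot>\<^bsub>t\<^esub> ?y"
      using htm_mult_col[OF L X j] htm_mult_col[OF L Y j] eq[of k] by simp
    also have "?L \<odot>\<^bsub>t\<^esub> ?y + (- 1) *\<^sub>h (?L \<odot>\<^bsub>t\<^esub> ?y) = 0\<^sub>m n 1"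
      using L xy by (intro eq_matI) (auto simp: htm_scale_def htm_mult_def)
    finally show ?thesis .
  qed
  then have "?x + (- 1) *\<^sub>h ?y = 0\<^sub>m N 1"
    using assms(1) xy by (auto simp: ht_kalman_observable_def)
  moreover have "?x = (?x + (- 1) *\<^sub>h ?y) + ?y"
    using xy by (intro eq_matI) (auto simp: htm_scale_def)
  ultimately show "?x = ?y" using xy by simp
qed

lemma ht_regular_resolvent:
  assumes A: "A \<in> carrier_mat N N" and "ht_regular t A x"
  shows "ht_resolvent t A x \<in> carrier_mat N N"
    "(htm_one N - x *\<^sub>h A) \<odot>\<^bsub>t\<^esub> ht_resolvent t A x = htm_one N"
    "ht_resolvent t A x \<odot>\<^bsub>t\<^esub> (htm_one N - x *\<^sub>h A) = htm_one N"
    "htm_inverse_of t (htm_one N - x *\<^sub>h A) (ht_resolvent t A x)"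
proof -
  have "dim_row A = N" using A by auto
  then have *: "htm_inverse_of t (htm_one N - x *\<^sub>h A) (ht_resolvent t A x)"
    using htm_inv_inverse_of assms(2) by (simp add: ht_regular_def ht_resolvent_def)
  then show "htm_inverse_of t (htm_one N - x *\<^sub>h A) (ht_resolvent t A x)" .
  have "htm_one N - x *\<^sub>h A \<in> carrier_mat N N" using A by (intro minus_carrier_mat) simp
  from htm_inverse_ofD[OF * this] show "ht_resolvent t A x \<in> carrier_mat N N"
    "(htm_one N - x *\<^sub>h A) \<odot>\<^bsub>t\<^esub> ht_resolvent t A x = htm_one N"
    "ht_resolvent t A x \<odot>\<^bsub>t\<^esub> (htm_one N - x *\<^sub>h A) = htm_one N" by auto
qed

text \<open>
  The zero column satisfies the defining equivalence of observability, and this already makes \<open>1 - x A\<close>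
  invertible near \<open>0\<close>. On such an interval the Neumann series turns vanishing of all \<open>C A\<^sup>k h\<close> into
  vanishing of \<open>C (1 - x A)\<^sup>-\<^sup>1 h\<close>.
\<close>

lemma
  assumes "ht_observable t n N C A" and C: "C \<in> carrier_mat n N" and A: "A \<in> carrier_mat N N"
  shows ht_observable_regular: "\<exists>\<epsilon>>0. \<forall>x. \<bar>x\<bar> < \<epsilon> \<longrightarrow> ht_regular t A x"
    and ht_observable_kalman: "ht_kalman_observable t n N C A"
proof -
  have "\<exists>\<epsilon>>0. \<forall>x\<in>{-\<epsilon><..<\<epsilon>}. ht_regular t A x"
    using assms(1) unfolding ht_observable_def by (metis zero_carrier_mat)
  then show *: "\<exists>\<epsilon>>0. \<forall>x. \<bar>x\<bar> < \<epsilon> \<longrightarrow> ht_regular t A x"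
    by (force simp: abs_less_iff)
  then obtain \<epsilon> where \<epsilon>: "\<epsilon> > 0" "\<And>x. \<bar>x\<bar> < \<epsilon> \<Longrightarrow> ht_regular t A x" by blast
  obtain r where r: "r > 0" "\<And>x a b R L X i j. \<bar>x\<bar> < r \<Longrightarrow> R \<in> carrier_mat N N \<Longrightarrow>
      (htm_one N - x *\<^sub>h A) \<odot>\<^bsub>t\<^esub> R = htm_one N \<Longrightarrow>
      L \<in> carrier_mat a N \<Longrightarrow> X \<in> carrier_mat N b \<Longrightarrow> i < a \<Longrightarrow> j < b \<Longrightarrow>
      (\<lambda>k. x ^ k *\<^sub>R ((L \<odot>\<^bsub>t\<^esub> htm_pow t A k \<odot>\<^bsub>t\<^esub> X) $$ (i, j))) sums ((L \<odot>\<^bsub>t\<^esub> R \<odot>\<^bsub>t\<^esub> X) $$ (i, j))"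
    by (rule resolvent_sums[OF A, where t = t]) (rule that)
  show "ht_kalman_observable t n N C A"
    unfolding ht_kalman_observable_def
  proof (intro ballI impI)
    fix h assume h: "h \<in> carrier_mat N 1" and h0: "\<forall>k. C \<odot>\<^bsub>t\<^esub> htm_pow t A k \<odot>\<^bsub>t\<^esub> h = 0\<^sub>m n 1"
    have "C \<odot>\<^bsub>t\<^esub> ht_resolvent t A x \<odot>\<^bsub>t\<^esub> h = 0\<^sub>m n 1" if x: "\<bar>x\<bar> < \<epsilon>" "\<bar>x\<bar> < r" for x
    proof (rule eq_matI)
      note R = ht_regular_resolvent[OF A \<epsilon>(2)[OF x(1)]]
      fix i j assume "i < dim_row (0\<^sub>m n 1 :: ht mat)" "j < dim_col (0\<^sub>m n 1 :: ht mat)"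
      then have ij: "i < n" "j < 1" by auto
      have "(\<lambda>k. x ^ k *\<^sub>R ((C \<odot>\<^bsub>t\<^esub> htm_pow t A k \<odot>\<^bsub>t\<^esub> h) $$ (i, j)))
          sums ((C \<odot>\<^bsub>t\<^esub> ht_resolvent t A x \<odot>\<^bsub>t\<^esub> h) $$ (i, j))"
        by (rule r(2)[OF x(2) R(1,2) C h ij])
      then show "(C \<odot>\<^bsub>t\<^esub> ht_resolvent t A x \<odot>\<^bsub>t\<^esub> h) $$ (i, j) = 0\<^sub>m n 1 $$ (i, j)"
        using h0 ij by (simp add: sums_unique2[OF _ sums_zero])
    qed (use C h in \<open>auto simp: htm_mult_def\<close>)
    then have "\<exists>\<epsilon>>0. \<forall>x\<in>{-\<epsilon><..<\<epsilon>}. ht_regular t A x \<and> C \<odot>\<^bsub>t\<^esub> ht_resolvent t A x \<odot>\<^bsub>t\<^esub> h = 0\<^sub>m n 1"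
      using \<epsilon> r(1) by (intro exI[of _ "min \<epsilon> r"]) (auto simp: abs_less_iff)
    then show "h = 0\<^sub>m N 1" using assms(1) h by (auto simp: ht_observable_def)
  qed
qed

text \<open>
  The Markov parameters \<open>C A\<^sup>k B\<close> are the Taylor coefficients of \<open>C (1 - x A)\<^sup>-\<^sup>1 B\<close> at \<open>0\<close>.
\<close>

lemma markov_parameters_eq:
  assumes A: "A \<in> carrier_mat N N" and A': "A' \<in> carrier_mat N' N'"
    and B: "B \<in> carrier_mat N p" and B': "B' \<in> carrier_mat N' p"
    and C: "C \<in> carrier_mat n N" and C': "C' \<in> carrier_mat n N'"
    and "\<epsilon> > 0"
    and eq: "\<And>x. x \<noteq> 0 \<Longrightarrow> \<bar>x\<bar> < \<epsilon> \<Longrightarrow> \<exists>R\<in>carrier_mat N N. \<exists>R'\<in>carrier_mat N' N'.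
      (htm_one N - x *\<^sub>h A) \<odot>\<^bsub>t\<^esub> R = htm_one N \<and> (htm_one N' - x *\<^sub>h A') \<odot>\<^bsub>t\<^esub> R' = htm_one N' \<and>
      C \<odot>\<^bsub>t\<^esub> R \<odot>\<^bsub>t\<^esub> B = C' \<odot>\<^bsub>t\<^esub> R' \<odot>\<^bsub>t\<^esub> B'"
  shows "C \<odot>\<^bsub>t\<^esub> htm_pow t A k \<odot>\<^bsub>t\<^esub> B = C' \<odot>\<^bsub>t\<^esub> htm_pow t A' k \<odot>\<^bsub>t\<^esub> B'"
proof -
  obtain r where r: "r > 0" "\<And>x a b R L X i j. \<bar>x\<bar> < r \<Longrightarrow> R \<in> carrier_mat N N \<Longrightarrow>
      (htm_one N - x *\<^sub>h A) \<odot>\<^bsub>t\<^esub> R = htm_one N \<Longrightarrow>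
      L \<in> carrier_mat a N \<Longrightarrow> X \<in> carrier_mat N b \<Longrightarrow> i < a \<Longrightarrow> j < b \<Longrightarrow>
      (\<lambda>k. x ^ k *\<^sub>R ((L \<odot>\<^bsub>t\<^esub> htm_pow t A k \<odot>\<^bsub>t\<^esub> X) $$ (i, j))) sums ((L \<odot>\<^bsub>t\<^esub> R \<odot>\<^bsub>t\<^esub> X) $$ (i, j))"
    by (rule resolvent_sums[OF A, where t = t]) (rule that)
  obtain r' where r': "r' > 0" "\<And>x a b R L X i j. \<bar>x\<bar> < r' \<Longrightarrow> R \<in> carrier_mat N' N' \<Longrightarrow>
      (htm_one N' - x *\<^sub>h A') \<odot>\<^bsub>t\<^esub> R = htm_one N' \<Longrightarrow>
      L \<in> carrier_mat a N' \<Longrightarrow> X \<in> carrier_mat N' b \<Longrightarrow> i < a \<Longrightarrow> j < b \<Longrightarrow>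
      (\<lambda>k. x ^ k *\<^sub>R ((L \<odot>\<^bsub>t\<^esub> htm_pow t A' k \<odot>\<^bsub>t\<^esub> X) $$ (i, j))) sums ((L \<odot>\<^bsub>t\<^esub> R \<odot>\<^bsub>t\<^esub> X) $$ (i, j))"
    by (rule resolvent_sums[OF A', where t = t]) (rule that)
  show ?thesis
  proof (rule eq_matI)
    fix i j
    assume "i < dim_row (C' \<odot>\<^bsub>t\<^esub> htm_pow t A' k \<odot>\<^bsub>t\<^esub> B')" "j < dim_col (C' \<odot>\<^bsub>t\<^esub> htm_pow t A' k \<odot>\<^bsub>t\<^esub> B')"
    then have ij: "i < n" "j < p" using C' B' by (auto simp: htm_mult_def)
    define c where "c = (\<lambda>k. (C \<odot>\<^bsub>t\<^esub> htm_pow t A k \<odot>\<^bsub>t\<^esub> B) $$ (i, j))"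
    define c' where "c' = (\<lambda>k. (C' \<odot>\<^bsub>t\<^esub> htm_pow t A' k \<odot>\<^bsub>t\<^esub> B') $$ (i, j))"
    have "c k - c' k = 0"
    proof (rule ht_power_series_zero[where c = "\<lambda>k. c k - c' k"])
      show "min \<epsilon> (min r r') > 0" using \<open>\<epsilon> > 0\<close> r(1) r'(1) by simp
      fix x :: real assume x: "x \<noteq> 0" "\<bar>x\<bar> < min \<epsilon> (min r r')"
      then obtain R R' where R: "R \<in> carrier_mat N N" "(htm_one N - x *\<^sub>h A) \<odot>\<^bsub>t\<^esub> R = htm_one N"
        and R': "R' \<in> carrier_mat N' N'" "(htm_one N' - x *\<^sub>h A') \<odot>\<^bsub>t\<^esub> R' = htm_one N'"
        and RR: "C \<odot>\<^bsub>t\<^esub> R \<odot>\<^bsub>t\<^esub> B = C' \<odot>\<^bsub>t\<^esub> R' \<odot>\<^bsub>t\<^esub> B'"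
        using eq[of x] by auto
      have "(\<lambda>k. x ^ k *\<^sub>R c k) sums ((C \<odot>\<^bsub>t\<^esub> R \<odot>\<^bsub>t\<^esub> B) $$ (i, j))"
        unfolding c_def using x by (intro r(2)[OF _ R C B ij]) simp
      moreover have "(\<lambda>k. x ^ k *\<^sub>R c' k) sums ((C \<odot>\<^bsub>t\<^esub> R \<odot>\<^bsub>t\<^esub> B) $$ (i, j))"
        unfolding c'_def RR using x by (intro r'(2)[OF _ R' C' B' ij]) simp
      ultimately have "(\<lambda>k. x ^ k *\<^sub>R c k - x ^ k *\<^sub>R c' k) sums 0"
        using sums_diff by force
      then show "(\<lambda>k. x ^ k *\<^sub>R (c k - c' k)) sums 0" by (simp add: scaleR_diff_right)
    qed
    then show "(C \<odot>\<^bsub>t\<^esub> htm_pow t A k \<odot>\<^bsub>t\<^esub> B) $$ (i, j) = (C' \<odot>\<^bsub>t\<^esub> htm_pow t A' k \<odot>\<^bsub>t\<^esub> B') $$ (i, j)"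
      by (simp add: c_def c'_def)
  qed (use B B' C C' in \<open>auto simp: htm_mult_def\<close>)
qed

section \<open>The state space isomorphism\<close>

text \<open>
  The columns \<open>v\<close> whose outputs \<open>C A\<^sup>m v\<close> are also the outputs \<open>C' A'\<^sup>m u\<close> of some state \<open>u\<close> form a real
  subspace. It contains \<open>A\<^sup>k B w\<close>, matched with \<open>u = A'\<^sup>k B' w\<close> by equality of the Markov parameters, so by
  controllability it is everything. Matching the unit columns gives the columns of \<open>S\<close>.
\<close>

lemma exists_intertwiner:
  assumes "t \<noteq> 0" and A: "A \<in> carrier_mat N N" and A': "A' \<in> carrier_mat N' N'"
    and B: "B \<in> carrier_mat N p" and B': "B' \<in> carrier_mat N' p"
    and C: "C \<in> carrier_mat n N" and C': "C' \<in> carrier_mat n N'"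
    and ctrl: "ht_controllable t p N A B"
    and markov: "\<And>k. C \<odot>\<^bsub>t\<^esub> htm_pow t A k \<odot>\<^bsub>t\<^esub> B = C' \<odot>\<^bsub>t\<^esub> htm_pow t A' k \<odot>\<^bsub>t\<^esub> B'"
  shows "\<exists>S\<in>carrier_mat N' N. \<forall>k. C \<odot>\<^bsub>t\<^esub> htm_pow t A k = C' \<odot>\<^bsub>t\<^esub> htm_pow t A' k \<odot>\<^bsub>t\<^esub> S"
proof -
  define O1 where "O1 = (\<lambda>m. C \<odot>\<^bsub>t\<^esub> htm_pow t A m)"
  define O2 where "O2 = (\<lambda>m. C' \<odot>\<^bsub>t\<^esub> htm_pow t A' m)"
  have O1: "O1 m \<in> carrier_mat n N" and O2: "O2 m \<in> carrier_mat n N'" for m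
    using A A' C C' by (auto simp: O1_def O2_def)
  define rel where "rel = (\<lambda>v u. \<forall>m. O1 m \<odot>\<^bsub>t\<^esub> v = O2 m \<odot>\<^bsub>t\<^esub> u)"
  define W where "W = {v \<in> carrier_mat N 1. \<exists>u\<in>carrier_mat N' 1. rel v u}"
  have "W = carrier_mat N 1"
  proof (rule controllable_columns_span[OF \<open>t \<noteq> 0\<close> A B ctrl])
    show "W \<subseteq> carrier_mat N 1" by (auto simp: W_def)
    show "0\<^sub>m N 1 \<in> W"
      by (auto simp: W_def rel_def htm_mult_zero(1)[OF O1] htm_mult_zero(1)[OF O2] intro!: bexI[of _ "0\<^sub>m N' 1"])
  next
    fix v w assume "v \<in> W" "w \<in> W"
    then obtain u u' where "v \<in> carrier_mat N 1" "w \<in> carrier_mat N 1"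
      "u \<in> carrier_mat N' 1" "u' \<in> carrier_mat N' 1" "rel v u" "rel w u'"
      by (auto simp: W_def)
    then show "v + w \<in> W"
      by (auto simp: W_def rel_def htm_mult_add[OF O1] htm_mult_add[OF O2] intro!: bexI[of _ "u + u'"])
  next
    fix c v assume "v \<in> W"
    then obtain u where "v \<in> carrier_mat N 1" "u \<in> carrier_mat N' 1" "rel v u"
      by (auto simp: W_def)
    then show "c *\<^sub>h v \<in> W"
      by (auto simp: W_def rel_def htm_mult_scale[OF O1] htm_mult_scale[OF O2] intro!: bexI[of _ "c *\<^sub>h u"])
  next
    fix k and w :: "ht mat" assume w: "w \<in> carrier_mat p 1"
    have shift: "X \<odot>\<^bsub>t\<^esub> htm_pow t M m \<odot>\<^bsub>t\<^esub> (htm_pow t M k \<odot>\<^bsub>t\<^esub> (Y \<odot>\<^bsub>t\<^esub> w))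
        = (X \<odot>\<^bsub>t\<^esub> htm_pow t M (m + k) \<odot>\<^bsub>t\<^esub> Y) \<odot>\<^bsub>t\<^esub> w"
      if M: "M \<in> carrier_mat d d" and X: "X \<in> carrier_mat n d" and Y: "Y \<in> carrier_mat d p" for M X Y :: "ht mat" and d m
    proof -
      have P: "htm_pow t M m \<in> carrier_mat d d" and Q: "htm_pow t M k \<in> carrier_mat d d" using M by auto
      show ?thesis
        using htm_assoc[of "X \<odot>\<^bsub>t\<^esub> htm_pow t M m" n d "htm_pow t M k" d "Y \<odot>\<^bsub>t\<^esub> w" 1 t]
          htm_assoc[OF X P Q, of t] htm_assoc[of "X \<odot>\<^bsub>t\<^esub> htm_pow t M (m + k)" n d Y p w 1 t] X Y M P Q w
        by (simp add: htm_pow_add[OF M])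
    qed
    show "htm_pow t A k \<odot>\<^bsub>t\<^esub> (B \<odot>\<^bsub>t\<^esub> w) \<in> W"
      using htm_mult_carrier[OF htm_pow_carrier[OF A] htm_mult_carrier[OF B w], of t k t]
        htm_mult_carrier[OF htm_pow_carrier[OF A'] htm_mult_carrier[OF B' w], of t k t]
        shift[OF A C B] shift[OF A' C' B']
      by (auto simp: W_def rel_def O1_def O2_def markov
          intro!: bexI[of _ "htm_pow t A' k \<odot>\<^bsub>t\<^esub> (B' \<odot>\<^bsub>t\<^esub> w)"])
  qed
  then have "\<exists>u\<in>carrier_mat N' 1. rel (htm_col (htm_one N) j) u" for j
    using htm_col_carrier[OF htm_one_carrier] by (auto simp: W_def)
  then obtain S where S: "S \<in> carrier_mat N' N" "\<forall>j<N. rel (htm_col (htm_one N) j) (htm_col S j)"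
    using htm_exists_cols[of N N' "\<lambda>j. rel (htm_col (htm_one N) j)"] by blast
  have "O1 k = O2 k \<odot>\<^bsub>t\<^esub> S" for k
  proof (rule htm_eq_cols[of _ n N])
    fix j assume "j < N"
    then show "htm_col (O1 k) j = htm_col (O2 k \<odot>\<^bsub>t\<^esub> S) j"
      using S htm_mult_col[OF O1[of k] htm_one_carrier \<open>j < N\<close>, of t] htm_mult_col[OF O2[of k] S(1) \<open>j < N\<close>, of t] O1
      by (simp add: rel_def htm_one_right[OF O1])
  qed (use O1 htm_mult_carrier[OF O2 S(1)] in auto)
  then show ?thesis using S(1) by (auto simp: O1_def O2_def)
qed

text \<open>
  The converse of the construction above: the relations \<open>C' S = C\<close> and \<open>S A = A' S\<close> force \<open>S\<close> to preserve
  outputs, so that observability of \<open>(C', A')\<close> leaves at most one such \<open>S\<close>.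
\<close>

lemma intertwine_pow:
  assumes A: "A \<in> carrier_mat N N" and A': "A' \<in> carrier_mat N' N'"
    and C': "C' \<in> carrier_mat n N'" and S: "S \<in> carrier_mat N' N"
    and "C' \<odot>\<^bsub>t\<^esub> S = C" "S \<odot>\<^bsub>t\<^esub> A = A' \<odot>\<^bsub>t\<^esub> S"
  shows "C \<odot>\<^bsub>t\<^esub> htm_pow t A k = C' \<odot>\<^bsub>t\<^esub> htm_pow t A' k \<odot>\<^bsub>t\<^esub> S"
proof -
  have "S \<odot>\<^bsub>t\<^esub> htm_pow t A k = htm_pow t A' k \<odot>\<^bsub>t\<^esub> S"
  proof (induction k)
    case 0
    show ?case using A A' S by simp
  next
    case (Suc k)
    have "S \<odot>\<^bsub>t\<^esub> htm_pow t A (Suc k) = S \<odot>\<^bsub>t\<^esub> htm_pow t A k \<odot>\<^bsub>t\<^esub> A"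
      using htm_assoc[OF S htm_pow_carrier[OF A] A] by simp
    also have "\<dots> = htm_pow t A' k \<odot>\<^bsub>t\<^esub> (S \<odot>\<^bsub>t\<^esub> A)"
      using Suc htm_assoc[OF htm_pow_carrier[OF A'] S A] by simp
    also have "\<dots> = htm_pow t A' (Suc k) \<odot>\<^bsub>t\<^esub> S"
      using assms(6) htm_assoc[OF htm_pow_carrier[OF A'] A' S] by simp
    finally show ?case .
  qed
  then show ?thesis
    using assms(5) htm_assoc[OF C' S htm_pow_carrier[OF A]] htm_assoc[OF C' htm_pow_carrier[OF A'] S]
    by metis
qed

text \<open>
  Exchanging the two realizations yields a map \<open>T\<close> in the other direction. Both are inverse to each other
  because their products preserve all outputs, so that observability identifies them with the identity;
  the intertwining relations follow in the same way.
\<close>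

lemma state_space_isomorphism:
  assumes "t \<noteq> 0" and A: "A \<in> carrier_mat N N" and A': "A' \<in> carrier_mat N' N'"
    and B: "B \<in> carrier_mat N p" and B': "B' \<in> carrier_mat N' p"
    and C: "C \<in> carrier_mat n N" and C': "C' \<in> carrier_mat n N'"
    and ctrl: "ht_controllable t p N A B" "ht_controllable t p N' A' B'"
    and obs: "ht_kalman_observable t n N C A" "ht_kalman_observable t n N' C' A'"
    and markov: "\<And>k. C \<odot>\<^bsub>t\<^esub> htm_pow t A k \<odot>\<^bsub>t\<^esub> B = C' \<odot>\<^bsub>t\<^esub> htm_pow t A' k \<odot>\<^bsub>t\<^esub> B'"
  shows "\<exists>S\<in>carrier_mat N' N. \<exists>T\<in>carrier_mat N N'. S \<odot>\<^bsub>t\<^esub> T = htm_one N' \<and> T \<odot>\<^bsub>t\<^esub> S = htm_one N \<and>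
    C' \<odot>\<^bsub>t\<^esub> S = C \<and> S \<odot>\<^bsub>t\<^esub> A = A' \<odot>\<^bsub>t\<^esub> S \<and> S \<odot>\<^bsub>t\<^esub> B = B'"
proof -
  obtain S where S: "S \<in> carrier_mat N' N"
    "\<And>k. C \<odot>\<^bsub>t\<^esub> htm_pow t A k = C' \<odot>\<^bsub>t\<^esub> htm_pow t A' k \<odot>\<^bsub>t\<^esub> S"
    using exists_intertwiner[OF \<open>t \<noteq> 0\<close> A A' B B' C C' ctrl(1) markov] by blast
  obtain T where T: "T \<in> carrier_mat N N'"
    "\<And>k. C' \<odot>\<^bsub>t\<^esub> htm_pow t A' k = C \<odot>\<^bsub>t\<^esub> htm_pow t A k \<odot>\<^bsub>t\<^esub> T"
    using exists_intertwiner[OF \<open>t \<noteq> 0\<close> A' A B' B C' C ctrl(2) markov[symmetric]] by blast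
  have O1: "C \<odot>\<^bsub>t\<^esub> htm_pow t A k \<in> carrier_mat n N" and O2: "C' \<odot>\<^bsub>t\<^esub> htm_pow t A' k \<in> carrier_mat n N'" for k
    using A A' C C' by auto
  have shift: "X \<odot>\<^bsub>t\<^esub> htm_pow t M k \<odot>\<^bsub>t\<^esub> M = X \<odot>\<^bsub>t\<^esub> htm_pow t M (Suc k)"
    if "X \<in> carrier_mat n d" "M \<in> carrier_mat d d" for X :: "ht mat" and M k d
    using htm_assoc[OF that(1) htm_pow_carrier[OF that(2)] that(2)] by simp
  have "S \<odot>\<^bsub>t\<^esub> T = htm_one N'"
  proof (rule kalman_observable_cancel[OF obs(2) C' A' htm_mult_carrier[OF S(1) T(1)] htm_one_carrier])
    fix k
    show "C' \<odot>\<^bsub>t\<^esub> htm_pow t A' k \<odot>\<^bsub>t\<^esub> (S \<odot>\<^bsub>t\<^esub> T) = C' \<odot>\<^bsub>t\<^esub> htm_pow t A' k \<odot>\<^bsub>t\<^esub> htm_one N'"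
      unfolding htm_assoc[OF O2[of k] S(1) T(1), symmetric] S(2)[symmetric] T(2)[symmetric] htm_one_right[OF O2] ..
  qed
  moreover have "T \<odot>\<^bsub>t\<^esub> S = htm_one N"
  proof (rule kalman_observable_cancel[OF obs(1) C A htm_mult_carrier[OF T(1) S(1)] htm_one_carrier])
    fix k
    show "C \<odot>\<^bsub>t\<^esub> htm_pow t A k \<odot>\<^bsub>t\<^esub> (T \<odot>\<^bsub>t\<^esub> S) = C \<odot>\<^bsub>t\<^esub> htm_pow t A k \<odot>\<^bsub>t\<^esub> htm_one N"
      unfolding htm_assoc[OF O1[of k] T(1) S(1), symmetric] T(2)[symmetric] S(2)[symmetric] htm_one_right[OF O1] ..
  qed
  moreover have "C' \<odot>\<^bsub>t\<^esub> S = C"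
    using S(2)[of 0] A A' C C' by (simp add: htm_one_right)
  moreover have "S \<odot>\<^bsub>t\<^esub> A = A' \<odot>\<^bsub>t\<^esub> S"
  proof (rule kalman_observable_cancel[OF obs(2) C' A' htm_mult_carrier[OF S(1) A] htm_mult_carrier[OF A' S(1)]])
    fix k
    show "C' \<odot>\<^bsub>t\<^esub> htm_pow t A' k \<odot>\<^bsub>t\<^esub> (S \<odot>\<^bsub>t\<^esub> A) = C' \<odot>\<^bsub>t\<^esub> htm_pow t A' k \<odot>\<^bsub>t\<^esub> (A' \<odot>\<^bsub>t\<^esub> S)"
      using htm_assoc[OF O2[of k] S(1) A, of t] htm_assoc[OF O2[of k] A' S(1), of t] S(2)[of k] S(2)[of "Suc k"]
        shift[OF C A, of k] shift[OF C' A', of k] by metis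
  qed
  moreover have "S \<odot>\<^bsub>t\<^esub> B = B'"
  proof (rule kalman_observable_cancel[OF obs(2) C' A' htm_mult_carrier[OF S(1) B] B'])
    fix k
    show "C' \<odot>\<^bsub>t\<^esub> htm_pow t A' k \<odot>\<^bsub>t\<^esub> (S \<odot>\<^bsub>t\<^esub> B) = C' \<odot>\<^bsub>t\<^esub> htm_pow t A' k \<odot>\<^bsub>t\<^esub> B'"
      using htm_assoc[OF O2[of k] S(1) B, of t] S(2)[of k] markov[of k] by metis
  qed
  ultimately show ?thesis using S(1) T(1) by blast
qed

section \<open>Duality under the adjoint\<close>

text \<open>
  Taking adjoints exchanges \<open>(C, A, B)\<close> with \<open>(B\<^sup>\<circledast>, - A\<^sup>\<circledast>, C\<^sup>\<circledast>)\<close> up to the sign \<open>(-1)\<^sup>k\<close>, which does not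
  affect annihilators. Hence it exchanges observability and controllability.
\<close>

lemma signed_pow_adj:
  assumes A: "A \<in> carrier_mat N N" and L: "L \<in> carrier_mat a N" and X: "X \<in> carrier_mat N b"
  shows "X\<^sup>\<circledast> \<odot>\<^bsub>t\<^esub> htm_pow t (- A\<^sup>\<circledast>) k \<odot>\<^bsub>t\<^esub> L\<^sup>\<circledast>
    = ((- 1) ^ k) *\<^sub>h (L \<odot>\<^bsub>t\<^esub> htm_pow t A k \<odot>\<^bsub>t\<^esub> X)\<^sup>\<circledast>"
proof -
  let ?P = "htm_pow t A k"
  have P: "?P \<in> carrier_mat N N" using A by simp
  have LP: "L \<odot>\<^bsub>t\<^esub> ?P \<in> carrier_mat a N" using L P by simp
  have Ps: "htm_pow t (- A\<^sup>\<circledast>) k = ((- 1) ^ k) *\<^sub>h ?P\<^sup>\<circledast>"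
    using A by (simp add: htm_pow_uminus[of _ N] htm_pow_adj[of _ N])
  have ca: "X\<^sup>\<circledast> \<in> carrier_mat b N" "?P\<^sup>\<circledast> \<in> carrier_mat N N" "L\<^sup>\<circledast> \<in> carrier_mat N a"
    using X P L by auto
  have "X\<^sup>\<circledast> \<odot>\<^bsub>t\<^esub> htm_pow t (- A\<^sup>\<circledast>) k \<odot>\<^bsub>t\<^esub> L\<^sup>\<circledast> = ((- 1) ^ k) *\<^sub>h (X\<^sup>\<circledast> \<odot>\<^bsub>t\<^esub> ?P\<^sup>\<circledast> \<odot>\<^bsub>t\<^esub> L\<^sup>\<circledast>)"
    unfolding Ps htm_mult_scale[OF ca(1,2)] htm_scale_mult[OF htm_mult_carrier[OF ca(1,2)] ca(3)] ..
  also have "X\<^sup>\<circledast> \<odot>\<^bsub>t\<^esub> ?P\<^sup>\<circledast> \<odot>\<^bsub>t\<^esub> L\<^sup>\<circledast> = (L \<odot>\<^bsub>t\<^esub> ?P \<odot>\<^bsub>t\<^esub> X)\<^sup>\<circledast>"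
    unfolding htm_assoc[OF ca] htm_adj_mult[OF LP X] htm_adj_mult[OF L P] ..
  finally show ?thesis .
qed

lemma htm_scale_eq_zero:
  assumes "M \<in> carrier_mat a b" "c *\<^sub>h M = 0\<^sub>m a b" "c \<noteq> 0"
  shows "M = 0\<^sub>m a b"
proof -
  have "inverse c *\<^sub>h c *\<^sub>h M = M" using assms(3) by simp
  then show ?thesis unfolding assms(2) by simp
qed

lemma controllable_adjoint:
  assumes A: "A \<in> carrier_mat N N" and B: "B \<in> carrier_mat N n" and ctrl: "ht_controllable t n N A B"
  shows "ht_kalman_observable t n N (B\<^sup>\<circledast>) (- A\<^sup>\<circledast>)"
  unfolding ht_kalman_observable_def
proof (intro ballI impI)
  fix h assume h: "h \<in> carrier_mat N 1"
    and h0: "\<forall>k. B\<^sup>\<circledast> \<odot>\<^bsub>t\<^esub> htm_pow t (- A\<^sup>\<circledast>) k \<odot>\<^bsub>t\<^esub> h = 0\<^sub>m n 1"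
  have hs: "h\<^sup>\<circledast> \<in> carrier_mat 1 N" using h by simp
  have "h\<^sup>\<circledast> \<odot>\<^bsub>t\<^esub> htm_pow t A k \<odot>\<^bsub>t\<^esub> B = 0\<^sub>m 1 n" for k
  proof -
    have M: "h\<^sup>\<circledast> \<odot>\<^bsub>t\<^esub> htm_pow t A k \<odot>\<^bsub>t\<^esub> B \<in> carrier_mat 1 n"
      using htm_mult_carrier[OF htm_mult_carrier[OF hs htm_pow_carrier[OF A]] B] .
    have scaled: "((- 1) ^ k) *\<^sub>h (h\<^sup>\<circledast> \<odot>\<^bsub>t\<^esub> htm_pow t A k \<odot>\<^bsub>t\<^esub> B)\<^sup>\<circledast> = 0\<^sub>m n 1"
      using h0 by (subst signed_pow_adj[OF A hs B, symmetric], subst htm_adj_adj) (rule spec)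
    have "(h\<^sup>\<circledast> \<odot>\<^bsub>t\<^esub> htm_pow t A k \<odot>\<^bsub>t\<^esub> B)\<^sup>\<circledast> = 0\<^sub>m n 1"
      by (rule htm_scale_eq_zero[OF _ scaled]) (use M in simp_all)
    then show ?thesis using htm_adj_eq_zero_iff[OF M] by simp
  qed
  then show "h = 0\<^sub>m N 1" using ctrl hs htm_adj_eq_zero_iff[OF h] by (auto simp: ht_controllable_def)
qed

lemma observable_adjoint:
  assumes A: "A \<in> carrier_mat N N" and C: "C \<in> carrier_mat n N" and obs: "ht_kalman_observable t n N C A"
  shows "ht_controllable t n N (- A\<^sup>\<circledast>) (C\<^sup>\<circledast>)"
  unfolding ht_controllable_def
proof (intro ballI iffI allI)
  fix h assume h: "h \<in> carrier_mat 1 N"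
    and h0: "\<forall>k. h \<odot>\<^bsub>t\<^esub> htm_pow t (- A\<^sup>\<circledast>) k \<odot>\<^bsub>t\<^esub> C\<^sup>\<circledast> = 0\<^sub>m 1 n"
  have hs: "h\<^sup>\<circledast> \<in> carrier_mat N 1" using h by simp
  have "C \<odot>\<^bsub>t\<^esub> htm_pow t A k \<odot>\<^bsub>t\<^esub> h\<^sup>\<circledast> = 0\<^sub>m n 1" for k
  proof -
    have M: "C \<odot>\<^bsub>t\<^esub> htm_pow t A k \<odot>\<^bsub>t\<^esub> h\<^sup>\<circledast> \<in> carrier_mat n 1"
      using htm_mult_carrier[OF htm_mult_carrier[OF C htm_pow_carrier[OF A]] hs] .
    have scaled: "((- 1) ^ k) *\<^sub>h (C \<odot>\<^bsub>t\<^esub> htm_pow t A k \<odot>\<^bsub>t\<^esub> h\<^sup>\<circledast>)\<^sup>\<circledast> = 0\<^sub>m 1 n"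
      using h0 by (subst signed_pow_adj[OF A C hs, symmetric], subst htm_adj_adj) (rule spec)
    have "(C \<odot>\<^bsub>t\<^esub> htm_pow t A k \<odot>\<^bsub>t\<^esub> h\<^sup>\<circledast>)\<^sup>\<circledast> = 0\<^sub>m 1 n"
      by (rule htm_scale_eq_zero[OF _ scaled]) (use M in simp_all)
    then show ?thesis using htm_adj_eq_zero_iff[OF M] by simp
  qed
  then have "h\<^sup>\<circledast> = 0\<^sub>m N 1" using obs hs by (auto simp: ht_kalman_observable_def)
  then show "h = 0\<^sub>m 1 N" using htm_adj_eq_zero_iff[OF h] by simp
next
  fix h :: "ht mat" and k assume h: "h = 0\<^sub>m 1 N"
  have "htm_pow t (- A\<^sup>\<circledast>) k \<in> carrier_mat N N" "C\<^sup>\<circledast> \<in> carrier_mat N n"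
    using A C by auto
  then show "h \<odot>\<^bsub>t\<^esub> htm_pow t (- A\<^sup>\<circledast>) k \<odot>\<^bsub>t\<^esub> C\<^sup>\<circledast> = 0\<^sub>m 1 n"
    by (simp only: h htm_mult_zero(2))
qed

section \<open>The associated Hermitian matrix\<close>

text \<open>
  With \<open>A K + K A\<^sup>\<circledast> = 0\<close> one has \<open>x K (1 - y A\<^sup>\<circledast>) + y (1 - x A) K = (x + y) K\<close>. Multiplying by the
  resolvents on both sides gives the identity.
\<close>

lemma associated_resolvent_identity:
  assumes A: "A \<in> carrier_mat N N" and K: "K \<in> carrier_mat N N"
    and R: "R \<in> carrier_mat N N" and R': "R' \<in> carrier_mat N N"
    and AK: "A \<odot>\<^bsub>t\<^esub> K + K \<odot>\<^bsub>t\<^esub> A\<^sup>\<circledast> = 0\<^sub>m N N"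
    and inv: "R \<odot>\<^bsub>t\<^esub> (htm_one N - x *\<^sub>h A) = htm_one N" "(htm_one N - y *\<^sub>h A\<^sup>\<circledast>) \<odot>\<^bsub>t\<^esub> R' = htm_one N"
  shows "(x + y) *\<^sub>h (R \<odot>\<^bsub>t\<^esub> (K \<odot>\<^bsub>t\<^esub> R')) = x *\<^sub>h (R \<odot>\<^bsub>t\<^esub> K) + y *\<^sub>h (K \<odot>\<^bsub>t\<^esub> R')"
proof -
  have As: "A\<^sup>\<circledast> \<in> carrier_mat N N" using A by simp
  note square = htm_assoc[where a = N and b = N and c = N and d = N]
    htm_add_mult[where a = N and b = N and c = N] htm_mult_add[where a = N and b = N and c = N]
    htm_scale_mult[where a = N and b = N and c = N] htm_mult_scale[where a = N and b = N and c = N]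
    htm_mult_carrier[where a = N and b = N and c = N] htm_minus_scale[where a = N and b = N]
    htm_one_right[where a = N and N = N] htm_one_left[where c = N and N = N]
  define M X Y where "M = R \<odot>\<^bsub>t\<^esub> (K \<odot>\<^bsub>t\<^esub> R')" and "X = R \<odot>\<^bsub>t\<^esub> (K \<odot>\<^bsub>t\<^esub> (A\<^sup>\<circledast> \<odot>\<^bsub>t\<^esub> R'))"
    and "Y = R \<odot>\<^bsub>t\<^esub> (A \<odot>\<^bsub>t\<^esub> (K \<odot>\<^bsub>t\<^esub> R'))"
  have car: "M \<in> carrier_mat N N" "X \<in> carrier_mat N N" "Y \<in> carrier_mat N N"
    using A As K R R' by (auto simp: M_def X_def Y_def square)
  have "R \<odot>\<^bsub>t\<^esub> K = R \<odot>\<^bsub>t\<^esub> K \<odot>\<^bsub>t\<^esub> ((htm_one N - y *\<^sub>h A\<^sup>\<circledast>) \<odot>\<^bsub>t\<^esub> R')"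
    using R K by (simp add: inv square)
  also have "\<dots> = M + (- y) *\<^sub>h X"
    using A As K R R' by (simp add: M_def X_def square)
  finally have RK: "R \<odot>\<^bsub>t\<^esub> K = M + (- y) *\<^sub>h X" .
  have "K \<odot>\<^bsub>t\<^esub> R' = R \<odot>\<^bsub>t\<^esub> (htm_one N - x *\<^sub>h A) \<odot>\<^bsub>t\<^esub> (K \<odot>\<^bsub>t\<^esub> R')"
    using R' K by (simp add: inv square)
  also have "\<dots> = M + (- x) *\<^sub>h Y"
    using A As K R R' by (simp add: M_def Y_def square)
  finally have KR: "K \<odot>\<^bsub>t\<^esub> R' = M + (- x) *\<^sub>h Y" .
  have "Y + X = R \<odot>\<^bsub>t\<^esub> ((A \<odot>\<^bsub>t\<^esub> K + K \<odot>\<^bsub>t\<^esub> A\<^sup>\<circledast>) \<odot>\<^bsub>t\<^esub> R')"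
    using A As K R R' by (simp add: X_def Y_def square)
  then have XY: "Y + X = 0\<^sub>m N N"
    using R R' by (simp add: AK)
  have "(x + y) *\<^sub>h M = x *\<^sub>h (M + (- y) *\<^sub>h X) + y *\<^sub>h (M + (- x) *\<^sub>h Y)"
  proof (rule eq_matI)
    fix i j
    assume "i < dim_row (x *\<^sub>h (M + (- y) *\<^sub>h X) + y *\<^sub>h (M + (- x) *\<^sub>h Y))"
      "j < dim_col (x *\<^sub>h (M + (- y) *\<^sub>h X) + y *\<^sub>h (M + (- x) *\<^sub>h Y))"
    then have ij: "i < N" "j < N" using car by (auto simp: htm_scale_def)
    have "Y $$ (i, j) + X $$ (i, j) = (Y + X) $$ (i, j)" using car ij by simp
    then have "Y $$ (i, j) = - X $$ (i, j)" using ij by (simp add: XY add_eq_0_iff2)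
    then show "((x + y) *\<^sub>h M) $$ (i, j) = (x *\<^sub>h (M + (- y) *\<^sub>h X) + y *\<^sub>h (M + (- x) *\<^sub>h Y)) $$ (i, j)"
      using car ij by (simp add: htm_scale_def algebra_simps)
  qed (use car in \<open>auto simp: htm_scale_def\<close>)
  then show ?thesis unfolding RK[symmetric] KR[symmetric] unfolding M_def .
qed

lemma ht_associated_inverse:
  assumes H: "ht_associated t n N D C A B H" and A: "A \<in> carrier_mat N N" and C: "C \<in> carrier_mat n N"
  defines "K \<equiv> htm_inv t H"
  shows "K \<in> carrier_mat N N" "H \<odot>\<^bsub>t\<^esub> K = htm_one N" "K \<odot>\<^bsub>t\<^esub> H = htm_one N" "K\<^sup>\<circledast> = K"
    "A \<odot>\<^bsub>t\<^esub> K + K \<odot>\<^bsub>t\<^esub> A\<^sup>\<circledast> = 0\<^sub>m N N" "B\<^sup>\<circledast> = C \<odot>\<^bsub>t\<^esub> K" "B\<^sup>\<circledast> \<odot>\<^bsub>t\<^esub> H = C" "H \<odot>\<^bsub>t\<^esub> B = C\<^sup>\<circledast>"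
    "H \<odot>\<^bsub>t\<^esub> A = - A\<^sup>\<circledast> \<odot>\<^bsub>t\<^esub> H"
proof -
  have Hc: "H \<in> carrier_mat N N" and Hs: "H\<^sup>\<circledast> = H" and AH: "A\<^sup>\<circledast> \<odot>\<^bsub>t\<^esub> H + H \<odot>\<^bsub>t\<^esub> A = 0\<^sub>m N N"
    and B: "B = K \<odot>\<^bsub>t\<^esub> C\<^sup>\<circledast>" and "htm_invertible t H"
    using H by (auto simp: ht_associated_def K_def)
  have inv: "htm_inverse_of t H K" using htm_inv_inverse_of \<open>htm_invertible t H\<close> by (simp add: K_def)
  note Kp = htm_inverse_ofD[OF inv Hc]
  show K: "K \<in> carrier_mat N N" and HK: "H \<odot>\<^bsub>t\<^esub> K = htm_one N" and KH: "K \<odot>\<^bsub>t\<^esub> H = htm_one N"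
    using Kp by auto
  show Ks: "K\<^sup>\<circledast> = K"
    using htm_inv_eqI[OF htm_inverse_of_adj[OF inv Hc]] by (simp add: Hs K_def)
  have As: "A\<^sup>\<circledast> \<in> carrier_mat N N" and Cs: "C\<^sup>\<circledast> \<in> carrier_mat N n" using A C by auto
  note square = htm_assoc[where a = N and b = N and c = N and d = N]
    htm_add_mult[where a = N and b = N and c = N] htm_mult_add[where a = N and b = N and c = N]
    htm_mult_carrier[where a = N and b = N and c = N] htm_one_right[where a = N and N = N]
    htm_one_left[where c = N and N = N]
  have "K \<odot>\<^bsub>t\<^esub> ((A\<^sup>\<circledast> \<odot>\<^bsub>t\<^esub> H + H \<odot>\<^bsub>t\<^esub> A) \<odot>\<^bsub>t\<^esub> K)
      = K \<odot>\<^bsub>t\<^esub> (A\<^sup>\<circledast> \<odot>\<^bsub>t\<^esub> (H \<odot>\<^bsub>t\<^esub> K)) + (K \<odot>\<^bsub>t\<^esub> H) \<odot>\<^bsub>t\<^esub> (A \<odot>\<^bsub>t\<^esub> K)"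
    using A As K Hc by (simp add: square)
  also have "\<dots> = K \<odot>\<^bsub>t\<^esub> A\<^sup>\<circledast> + A \<odot>\<^bsub>t\<^esub> K"
    using A As K Hc by (simp add: square HK KH)
  also have "\<dots> = A \<odot>\<^bsub>t\<^esub> K + K \<odot>\<^bsub>t\<^esub> A\<^sup>\<circledast>"
    by (intro comm_add_mat[of _ N N]) (use A As K in \<open>auto simp: square\<close>)
  finally show "A \<odot>\<^bsub>t\<^esub> K + K \<odot>\<^bsub>t\<^esub> A\<^sup>\<circledast> = 0\<^sub>m N N"
    using K by (simp add: AH)
  show Bs: "B\<^sup>\<circledast> = C \<odot>\<^bsub>t\<^esub> K" using htm_adj_mult[OF K Cs] by (simp add: B Ks)
  show "B\<^sup>\<circledast> \<odot>\<^bsub>t\<^esub> H = C" using htm_assoc[OF C K Hc] C by (simp add: Bs KH htm_one_right[OF C])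
  show "H \<odot>\<^bsub>t\<^esub> B = C\<^sup>\<circledast>"
    using htm_assoc[OF Hc K Cs, symmetric] by (simp add: B HK htm_one_left[OF Cs])
  have "H \<odot>\<^bsub>t\<^esub> A = (A\<^sup>\<circledast> \<odot>\<^bsub>t\<^esub> H + H \<odot>\<^bsub>t\<^esub> A) + (- 1) *\<^sub>h (A\<^sup>\<circledast> \<odot>\<^bsub>t\<^esub> H)"
    using A As Hc by (intro eq_matI) (auto simp: htm_scale_def htm_mult_def)
  then show "H \<odot>\<^bsub>t\<^esub> A = - A\<^sup>\<circledast> \<odot>\<^bsub>t\<^esub> H"
    using htm_scale_mult[OF As Hc] htm_mult_carrier[OF As Hc] by (simp add: AH htm_uminus_scale)
qed

lemma ht_resolvent_adjoint:
  assumes A: "A \<in> carrier_mat N N" and x: "ht_regular t A x"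
  shows "htm_inverse_of t (htm_one N - x *\<^sub>h A\<^sup>\<circledast>) ((ht_resolvent t A x)\<^sup>\<circledast>)"
    "(htm_one N - x *\<^sub>h A\<^sup>\<circledast>) \<odot>\<^bsub>t\<^esub> (ht_resolvent t A x)\<^sup>\<circledast> = htm_one N"
proof -
  have M: "htm_one N - x *\<^sub>h A \<in> carrier_mat N N" "htm_one N - x *\<^sub>h A\<^sup>\<circledast> \<in> carrier_mat N N"
    using A by (auto intro!: minus_carrier_mat)
  have "(htm_one N - x *\<^sub>h A)\<^sup>\<circledast> = htm_one N - x *\<^sub>h A\<^sup>\<circledast>"
    using A by (simp add: htm_minus_scale[of _ N N] htm_adj_add[of _ N N] htm_adj_scale)
  then show *: "htm_inverse_of t (htm_one N - x *\<^sub>h A\<^sup>\<circledast>) ((ht_resolvent t A x)\<^sup>\<circledast>)"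
    using htm_inverse_of_adj[OF ht_regular_resolvent(4)[OF A x] M(1)] by simp
  show "(htm_one N - x *\<^sub>h A\<^sup>\<circledast>) \<odot>\<^bsub>t\<^esub> (ht_resolvent t A x)\<^sup>\<circledast> = htm_one N"
    by (rule htm_inverse_ofD(2)[OF * M(2)])
qed

text \<open>
  The kernel identity with the denominator \<open>x + y\<close> cleared. In this form \<open>y = - x\<close> is permitted and gives
  the symmetry of \<open>\<phi>\<close>.
\<close>

lemma ht_associated_kernel_identity:
  assumes H: "ht_associated t n N D C A B H" and A: "A \<in> carrier_mat N N" and C: "C \<in> carrier_mat n N"
    and D: "D \<in> carrier_mat n n" and B: "B \<in> carrier_mat N n"
    and x: "ht_regular t A x" and y: "ht_regular t A y"
  shows "(D + x *\<^sub>h (C \<odot>\<^bsub>t\<^esub> ht_resolvent t A x \<odot>\<^bsub>t\<^esub> B)) + (D + y *\<^sub>h (C \<odot>\<^bsub>t\<^esub> ht_resolvent t A y \<odot>\<^bsub>t\<^esub> B))\<^sup>\<circledast>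
    = (x + y) *\<^sub>h (C \<odot>\<^bsub>t\<^esub> ht_resolvent t A x \<odot>\<^bsub>t\<^esub> htm_inv t H \<odot>\<^bsub>t\<^esub> (ht_resolvent t A y)\<^sup>\<circledast> \<odot>\<^bsub>t\<^esub> C\<^sup>\<circledast>)"
proof -
  define K R S where "K = htm_inv t H" and "R = ht_resolvent t A x" and "S = ht_resolvent t A y"
  note Kp = ht_associated_inverse[OF H A C, folded K_def]
  note Rp = ht_regular_resolvent[OF A x, folded R_def]
  note Sp = ht_regular_resolvent[OF A y, folded S_def]
  note Sp_adj = ht_resolvent_adjoint(2)[OF A y, folded S_def]
  have BK: "B = K \<odot>\<^bsub>t\<^esub> C\<^sup>\<circledast>" and DD: "D + D\<^sup>\<circledast> = 0\<^sub>m n n" using H by (auto simp: ht_associated_def K_def)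
  have Cs: "C\<^sup>\<circledast> \<in> carrier_mat N n" and Ss: "S\<^sup>\<circledast> \<in> carrier_mat N N" using C Sp by auto
  from associated_resolvent_identity[OF A Kp(1) Rp(1) Ss Kp(5) Rp(3) Sp_adj]
  have id: "(x + y) *\<^sub>h (R \<odot>\<^bsub>t\<^esub> (K \<odot>\<^bsub>t\<^esub> S\<^sup>\<circledast>)) = x *\<^sub>h (R \<odot>\<^bsub>t\<^esub> K) + y *\<^sub>h (K \<odot>\<^bsub>t\<^esub> S\<^sup>\<circledast>)" .
  have RK: "R \<odot>\<^bsub>t\<^esub> K \<in> carrier_mat N N" and KS: "K \<odot>\<^bsub>t\<^esub> S\<^sup>\<circledast> \<in> carrier_mat N N"
    using htm_mult_carrier[OF Rp(1) Kp(1)] htm_mult_carrier[OF Kp(1) Ss] .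
  have RKS: "R \<odot>\<^bsub>t\<^esub> (K \<odot>\<^bsub>t\<^esub> S\<^sup>\<circledast>) \<in> carrier_mat N N" by (rule htm_mult_carrier[OF Rp(1) KS])
  have CR: "C \<odot>\<^bsub>t\<^esub> R \<in> carrier_mat n N" and CS: "C \<odot>\<^bsub>t\<^esub> S \<in> carrier_mat n N"
    using htm_mult_carrier[OF C Rp(1)] htm_mult_carrier[OF C Sp(1)] .
  have "C \<odot>\<^bsub>t\<^esub> R \<odot>\<^bsub>t\<^esub> K \<odot>\<^bsub>t\<^esub> S\<^sup>\<circledast> \<odot>\<^bsub>t\<^esub> C\<^sup>\<circledast> = C \<odot>\<^bsub>t\<^esub> (R \<odot>\<^bsub>t\<^esub> (K \<odot>\<^bsub>t\<^esub> S\<^sup>\<circledast>)) \<odot>\<^bsub>t\<^esub> C\<^sup>\<circledast>"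
    unfolding htm_assoc[OF C Rp(1) KS, symmetric] htm_assoc[OF CR Kp(1) Ss] ..
  then have "(x + y) *\<^sub>h (C \<odot>\<^bsub>t\<^esub> R \<odot>\<^bsub>t\<^esub> K \<odot>\<^bsub>t\<^esub> S\<^sup>\<circledast> \<odot>\<^bsub>t\<^esub> C\<^sup>\<circledast>)
      = C \<odot>\<^bsub>t\<^esub> ((x + y) *\<^sub>h (R \<odot>\<^bsub>t\<^esub> (K \<odot>\<^bsub>t\<^esub> S\<^sup>\<circledast>))) \<odot>\<^bsub>t\<^esub> C\<^sup>\<circledast>"
    unfolding htm_mult_scale[OF C RKS] htm_scale_mult[OF htm_mult_carrier[OF C RKS] Cs] by simp
  also have "\<dots> = C \<odot>\<^bsub>t\<^esub> (x *\<^sub>h (R \<odot>\<^bsub>t\<^esub> K) + y *\<^sub>h (K \<odot>\<^bsub>t\<^esub> S\<^sup>\<circledast>)) \<odot>\<^bsub>t\<^esub> C\<^sup>\<circledast>" by (simp only: id)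
  also have "\<dots> = x *\<^sub>h (C \<odot>\<^bsub>t\<^esub> (R \<odot>\<^bsub>t\<^esub> K) \<odot>\<^bsub>t\<^esub> C\<^sup>\<circledast>) + y *\<^sub>h (C \<odot>\<^bsub>t\<^esub> (K \<odot>\<^bsub>t\<^esub> S\<^sup>\<circledast>) \<odot>\<^bsub>t\<^esub> C\<^sup>\<circledast>)"
    using htm_mult_add[OF C, of "x *\<^sub>h (R \<odot>\<^bsub>t\<^esub> K)" N "y *\<^sub>h (K \<odot>\<^bsub>t\<^esub> S\<^sup>\<circledast>)" t] RK KS
      htm_mult_scale[OF C RK, of t x] htm_mult_scale[OF C KS, of t y]
      htm_mult_carrier[OF C RK] htm_mult_carrier[OF C KS]
      htm_add_mult[OF _ _ Cs, of "x *\<^sub>h (C \<odot>\<^bsub>t\<^esub> (R \<odot>\<^bsub>t\<^esub> K))" n "y *\<^sub>h (C \<odot>\<^bsub>t\<^esub> (K \<odot>\<^bsub>t\<^esub> S\<^sup>\<circledast>))" t]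
      htm_scale_mult[OF htm_mult_carrier[OF C RK] Cs, of x t t] htm_scale_mult[OF htm_mult_carrier[OF C KS] Cs, of y t t]
    by simp
  also have "C \<odot>\<^bsub>t\<^esub> (R \<odot>\<^bsub>t\<^esub> K) \<odot>\<^bsub>t\<^esub> C\<^sup>\<circledast> = C \<odot>\<^bsub>t\<^esub> R \<odot>\<^bsub>t\<^esub> B"
    unfolding BK htm_assoc[OF C Rp(1) Kp(1), symmetric] htm_assoc[OF CR Kp(1) Cs] ..
  also have "C \<odot>\<^bsub>t\<^esub> (K \<odot>\<^bsub>t\<^esub> S\<^sup>\<circledast>) \<odot>\<^bsub>t\<^esub> C\<^sup>\<circledast> = (C \<odot>\<^bsub>t\<^esub> S \<odot>\<^bsub>t\<^esub> B)\<^sup>\<circledast>"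
    unfolding htm_adj_mult[OF CS B] htm_adj_mult[OF C Sp(1)] Kp(6) htm_assoc[OF C Kp(1) Ss, symmetric]
    by (rule htm_assoc[OF htm_mult_carrier[OF C Kp(1)] Ss Cs])
  finally have *: "(x + y) *\<^sub>h (C \<odot>\<^bsub>t\<^esub> R \<odot>\<^bsub>t\<^esub> K \<odot>\<^bsub>t\<^esub> S\<^sup>\<circledast> \<odot>\<^bsub>t\<^esub> C\<^sup>\<circledast>)
      = x *\<^sub>h (C \<odot>\<^bsub>t\<^esub> R \<odot>\<^bsub>t\<^esub> B) + y *\<^sub>h (C \<odot>\<^bsub>t\<^esub> S \<odot>\<^bsub>t\<^esub> B)\<^sup>\<circledast>" .
  define F G where "F = x *\<^sub>h (C \<odot>\<^bsub>t\<^esub> R \<odot>\<^bsub>t\<^esub> B)" and "G = y *\<^sub>h (C \<odot>\<^bsub>t\<^esub> S \<odot>\<^bsub>t\<^esub> B)"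
  have FG: "F \<in> carrier_mat n n" "G \<in> carrier_mat n n"
    using htm_mult_carrier[OF CR B] htm_mult_carrier[OF CS B] by (simp_all add: F_def G_def)
  have "(D + F) + (D + G)\<^sup>\<circledast> = (D + D\<^sup>\<circledast>) + (F + G\<^sup>\<circledast>)"
    unfolding htm_adj_add[OF D FG(2)] using D FG
    by (intro eq_matI) (auto simp: htm_adj_def)
  also have "\<dots> = F + G\<^sup>\<circledast>" using FG by (simp add: DD)
  finally show ?thesis using * by (simp add: F_def G_def htm_adj_scale K_def R_def S_def)
qed

lemma ht_associated_unique:
  assumes A: "A \<in> carrier_mat N N" and B: "B \<in> carrier_mat N n" and C: "C \<in> carrier_mat n N"
    and "ht_controllable t n N A B"
    and "ht_associated t n N D C A B H" "ht_associated t n N D C A B H'"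
  shows "H = H'"
proof (rule kalman_observable_cancel[OF controllable_adjoint[OF A B \<open>ht_controllable t n N A B\<close>]])
  show H: "H \<in> carrier_mat N N" and H': "H' \<in> carrier_mat N N"
    using assms by (auto simp: ht_associated_def)
  show A': "- A\<^sup>\<circledast> \<in> carrier_mat N N" and B': "B\<^sup>\<circledast> \<in> carrier_mat n N" using A B by auto
  fix k
  show "B\<^sup>\<circledast> \<odot>\<^bsub>t\<^esub> htm_pow t (- A\<^sup>\<circledast>) k \<odot>\<^bsub>t\<^esub> H = B\<^sup>\<circledast> \<odot>\<^bsub>t\<^esub> htm_pow t (- A\<^sup>\<circledast>) k \<odot>\<^bsub>t\<^esub> H'"
    using intertwine_pow[OF A A' B' H ht_associated_inverse(7,9)[OF assms(5) A C]]
      intertwine_pow[OF A A' B' H' ht_associated_inverse(7,9)[OF assms(6) A C]]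
    by metis
qed

text \<open>
  The symmetry says that \<open>(C, A, B)\<close> and \<open>(B\<^sup>\<circledast>, - A\<^sup>\<circledast>, C\<^sup>\<circledast>)\<close> realize the same function, so that \<open>H\<close> is the
  isomorphism between their state spaces. The adjoint of \<open>H\<close> intertwines the same two realizations, and
  uniqueness forces \<open>H = H\<^sup>\<circledast>\<close>.
\<close>

lemma skew_symmetric_imp_associated:
  assumes "t \<noteq> 0" and A: "A \<in> carrier_mat N N" and B: "B \<in> carrier_mat N n"
    and C: "C \<in> carrier_mat n N" and D: "D \<in> carrier_mat n n"
    and ctrl: "ht_controllable t n N A B" and obs: "ht_observable t n N C A"
    and skew: "\<And>x. ht_regular t A x \<Longrightarrow> ht_regular t A (- x) \<Longrightarrow>
      D + x *\<^sub>h (C \<odot>\<^bsub>t\<^esub> ht_resolvent t A x \<odot>\<^bsub>t\<^esub> B)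
        = - (D + (- x) *\<^sub>h (C \<odot>\<^bsub>t\<^esub> ht_resolvent t A (- x) \<odot>\<^bsub>t\<^esub> B))\<^sup>\<circledast>"
  shows "\<exists>H. ht_associated t n N D C A B H"
proof -
  let ?A = "- A\<^sup>\<circledast>"
  obtain \<epsilon> where \<epsilon>: "\<epsilon> > 0" "\<And>x. \<bar>x\<bar> < \<epsilon> \<Longrightarrow> ht_regular t A x"
    using ht_observable_regular[OF obs C A] by blast
  have A': "?A \<in> carrier_mat N N" and B': "B\<^sup>\<circledast> \<in> carrier_mat n N" and C': "C\<^sup>\<circledast> \<in> carrier_mat N n"
    using A B C by auto
  have CRB: "C \<odot>\<^bsub>t\<^esub> ht_resolvent t A x \<odot>\<^bsub>t\<^esub> B \<in> carrier_mat n n" if "\<bar>x\<bar> < \<epsilon>" for x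
    using htm_mult_carrier[OF htm_mult_carrier[OF C ht_regular_resolvent(1)[OF A \<epsilon>(2)[OF that]]] B] .
  have "D = - D\<^sup>\<circledast>"
    using skew[of 0] \<epsilon>(1) \<epsilon>(2)[of 0] D CRB[of 0] by simp
  then have DD: "D + D\<^sup>\<circledast> = 0\<^sub>m n n"
    using D by (metis htm_adj_carrier uminus_l_inv_mat)
  have markov: "C \<odot>\<^bsub>t\<^esub> htm_pow t A k \<odot>\<^bsub>t\<^esub> B = B\<^sup>\<circledast> \<odot>\<^bsub>t\<^esub> htm_pow t ?A k \<odot>\<^bsub>t\<^esub> C\<^sup>\<circledast>" for k
  proof (rule markov_parameters_eq[OF A A' B C' C B' \<epsilon>(1)])
    fix x :: real assume x: "x \<noteq> 0" "\<bar>x\<bar> < \<epsilon>"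
    define R S where "R = ht_resolvent t A x" and "S = ht_resolvent t A (- x)"
    note Rp = ht_regular_resolvent[OF A \<epsilon>(2)[OF x(2)], folded R_def]
    have nx: "\<bar>- x\<bar> < \<epsilon>" using x by simp
    note Sp = ht_regular_resolvent[OF A \<epsilon>(2)[OF nx], folded S_def]
    have Ss: "S\<^sup>\<circledast> \<in> carrier_mat N N" using Sp by simp
    have inv: "(htm_one N - x *\<^sub>h ?A) \<odot>\<^bsub>t\<^esub> S\<^sup>\<circledast> = htm_one N"
      using ht_resolvent_adjoint(2)[OF A \<epsilon>(2)[OF nx], folded S_def] by (simp add: htm_uminus_scale)
    define F G where "F = C \<odot>\<^bsub>t\<^esub> R \<odot>\<^bsub>t\<^esub> B" and "G = C \<odot>\<^bsub>t\<^esub> S \<odot>\<^bsub>t\<^esub> B"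
    have FG: "F \<in> carrier_mat n n" "G \<in> carrier_mat n n"
      using CRB[OF x(2)] CRB[OF nx] by (simp_all add: F_def G_def R_def S_def)
    have "D + x *\<^sub>h F = - (D + (- x) *\<^sub>h G)\<^sup>\<circledast>"
      using skew[OF \<epsilon>(2)[OF x(2)] \<epsilon>(2)[OF nx]] by (simp add: F_def G_def R_def S_def)
    also have "\<dots> = - D\<^sup>\<circledast> + x *\<^sub>h G\<^sup>\<circledast>"
      using D FG by (intro eq_matI) (auto simp: htm_adj_def htm_scale_def ht_conj_def prod_eq_iff)
    also have "\<dots> = D + x *\<^sub>h G\<^sup>\<circledast>" using \<open>D = - D\<^sup>\<circledast>\<close> by simp
    finally have eq: "D + x *\<^sub>h F = D + x *\<^sub>h G\<^sup>\<circledast>" .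
    have "F = G\<^sup>\<circledast>"
    proof (rule eq_matI)
      fix i j assume ij: "i < dim_row (G\<^sup>\<circledast>)" "j < dim_col (G\<^sup>\<circledast>)"
      then have "(D + x *\<^sub>h F) $$ (i, j) = D $$ (i, j) + x *\<^sub>R F $$ (i, j)"
        "(D + x *\<^sub>h G\<^sup>\<circledast>) $$ (i, j) = D $$ (i, j) + x *\<^sub>R G\<^sup>\<circledast> $$ (i, j)"
        using D FG by (auto simp: htm_scale_def htm_adj_def)
      then show "F $$ (i, j) = G\<^sup>\<circledast> $$ (i, j)" using eq x(1) by simp
    qed (use FG in \<open>auto simp: htm_adj_def\<close>)
    also have "G\<^sup>\<circledast> = B\<^sup>\<circledast> \<odot>\<^bsub>t\<^esub> S\<^sup>\<circledast> \<odot>\<^bsub>t\<^esub> C\<^sup>\<circledast>"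
      unfolding G_def htm_adj_mult[OF htm_mult_carrier[OF C Sp(1)] B] htm_adj_mult[OF C Sp(1)]
      by (rule htm_assoc[OF B' Ss C', symmetric])
    finally show "\<exists>R\<in>carrier_mat N N. \<exists>R'\<in>carrier_mat N N.
      (htm_one N - x *\<^sub>h A) \<odot>\<^bsub>t\<^esub> R = htm_one N \<and> (htm_one N - x *\<^sub>h ?A) \<odot>\<^bsub>t\<^esub> R' = htm_one N \<and>
      C \<odot>\<^bsub>t\<^esub> R \<odot>\<^bsub>t\<^esub> B = B\<^sup>\<circledast> \<odot>\<^bsub>t\<^esub> R' \<odot>\<^bsub>t\<^esub> C\<^sup>\<circledast>"
      unfolding F_def using Rp(1,2) Ss inv by (intro bexI[of _ R] bexI[of _ "S\<^sup>\<circledast>"] conjI)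
  qed
  note kal = ht_observable_kalman[OF obs C A]
  note kal' = controllable_adjoint[OF A B ctrl]
  obtain H T where H: "H \<in> carrier_mat N N" and T: "T \<in> carrier_mat N N"
    and HT: "H \<odot>\<^bsub>t\<^esub> T = htm_one N" "T \<odot>\<^bsub>t\<^esub> H = htm_one N"
    and BH: "B\<^sup>\<circledast> \<odot>\<^bsub>t\<^esub> H = C" and HA: "H \<odot>\<^bsub>t\<^esub> A = ?A \<odot>\<^bsub>t\<^esub> H" and HB: "H \<odot>\<^bsub>t\<^esub> B = C\<^sup>\<circledast>"
    using state_space_isomorphism[OF \<open>t \<noteq> 0\<close> A A' B C' C B' ctrl observable_adjoint[OF A C kal] kal kal' markov]
    by blast
  have Hs: "H\<^sup>\<circledast> \<in> carrier_mat N N" using H by simp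
  have BHs: "B\<^sup>\<circledast> \<odot>\<^bsub>t\<^esub> H\<^sup>\<circledast> = C" using htm_adj_mult[OF H B, of t] by (simp add: HB)
  have As: "A\<^sup>\<circledast> \<in> carrier_mat N N" using A by simp
  have neg: "?A \<odot>\<^bsub>t\<^esub> X = - (A\<^sup>\<circledast> \<odot>\<^bsub>t\<^esub> X)" if "X \<in> carrier_mat N N" for X
    using htm_scale_mult[OF As that] by (simp add: htm_uminus_scale)
  have "A\<^sup>\<circledast> \<odot>\<^bsub>t\<^esub> H\<^sup>\<circledast> = - (H\<^sup>\<circledast> \<odot>\<^bsub>t\<^esub> A)"
    using htm_adj_mult[OF H A, of t] htm_adj_mult[OF As H, of t] HA neg[OF H]
    by (simp add: htm_uminus_scale htm_adj_scale)
  then have HsA: "H\<^sup>\<circledast> \<odot>\<^bsub>t\<^esub> A = ?A \<odot>\<^bsub>t\<^esub> H\<^sup>\<circledast>" using neg[OF Hs] by simp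
  have "H = H\<^sup>\<circledast>"
  proof (rule kalman_observable_cancel[OF kal' B' A' H Hs])
    show "B\<^sup>\<circledast> \<odot>\<^bsub>t\<^esub> htm_pow t ?A k \<odot>\<^bsub>t\<^esub> H = B\<^sup>\<circledast> \<odot>\<^bsub>t\<^esub> htm_pow t ?A k \<odot>\<^bsub>t\<^esub> H\<^sup>\<circledast>" for k
      using intertwine_pow[OF A A' B' H BH HA] intertwine_pow[OF A A' B' Hs BHs HsA] by metis
  qed
  moreover have inv: "htm_inverse_of t H T" by (rule htm_inverse_ofI[OF H T HT])
  moreover have "A\<^sup>\<circledast> \<odot>\<^bsub>t\<^esub> H + H \<odot>\<^bsub>t\<^esub> A = 0\<^sub>m N N"
    unfolding HA neg[OF H] using htm_mult_carrier[OF As H, of t] by (intro eq_matI) auto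
  moreover have "B = htm_inv t H \<odot>\<^bsub>t\<^esub> C\<^sup>\<circledast>"
    using htm_assoc[OF T H B, of t] htm_inv_eqI[OF inv] by (simp add: HT HB htm_one_left[OF B])
  ultimately show ?thesis
    using H DD by (auto simp: ht_associated_def htm_invertible_def)
qed

theorem theorem6p1:
  fixes t :: real and n N :: nat and \<phi> :: "real \<rightharpoonup> ht mat" and A B C D :: "ht mat"
  assumes "t \<noteq> 0"
    and "ht_rational t n \<phi>"
    and "ht_minimal_realization t n N \<phi> D C A B"
  shows "((\<forall>x. x \<in> dom \<phi> \<and> -x \<in> dom \<phi> \<longrightarrow> the (\<phi> x) = - (the (\<phi> (-x)))\<^sup>\<circledast>) \<longleftrightarrow>
            (\<exists>H. ht_associated t n N D C A B H)) \<and>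
         (\<forall>H H'. ht_associated t n N D C A B H \<and> ht_associated t n N D C A B H' \<longrightarrow> H = H') \<and>
         (\<forall>H. ht_associated t n N D C A B H \<longrightarrow>
            (\<forall>x\<in>dom \<phi>. the (\<phi> x) =
               D + x *\<^sub>h (C \<odot>\<^bsub>t\<^esub> htm_inv t (htm_one N - x *\<^sub>h A) \<odot>\<^bsub>t\<^esub> htm_inv t H \<odot>\<^bsub>t\<^esub> C\<^sup>\<circledast>)) \<and>
            (\<forall>x\<in>dom \<phi>. \<forall>y\<in>dom \<phi>. x + y \<noteq> 0 \<longrightarrow>
               (1 / (x + y)) *\<^sub>h (the (\<phi> x) + (the (\<phi> y))\<^sup>\<circledast>) =
               C \<odot>\<^bsub>t\<^esub> htm_inv t (htm_one N - x *\<^sub>h A) \<odot>\<^bsub>t\<^esub> htm_inv t H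
                 \<odot>\<^bsub>t\<^esub> htm_inv t (htm_one N - y *\<^sub>h A\<^sup>\<circledast>) \<odot>\<^bsub>t\<^esub> C\<^sup>\<circledast>))"
proof -
  have real: "ht_realization t n N \<phi> D C A B" and obs: "ht_observable t n N C A"
    and ctrl: "ht_controllable t n N A B"
    using assms(3) by (auto simp: ht_minimal_realization_def)
  have D: "D \<in> carrier_mat n n" and C: "C \<in> carrier_mat n N" and A: "A \<in> carrier_mat N N"
    and B: "B \<in> carrier_mat N n" and dom: "x \<in> dom \<phi> \<longleftrightarrow> ht_regular t A x" for x
    using real unfolding ht_realization_def by auto
  have \<phi>: "the (\<phi> x) = D + x *\<^sub>h (C \<odot>\<^bsub>t\<^esub> ht_resolvent t A x \<odot>\<^bsub>t\<^esub> B)" if "ht_regular t A x" for x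
    using real that unfolding dom[symmetric] ht_realization_def by simp
  have resolvent: "htm_inv t (htm_one N - x *\<^sub>h A) = ht_resolvent t A x" for x
    using A by (auto simp: ht_resolvent_def)
  have resolvent_adj: "htm_inv t (htm_one N - x *\<^sub>h A\<^sup>\<circledast>) = (ht_resolvent t A x)\<^sup>\<circledast>"
    if x: "ht_regular t A x" for x
    by (rule htm_inv_eqI[OF ht_resolvent_adjoint(1)[OF A x]])
  have CRB: "C \<odot>\<^bsub>t\<^esub> ht_resolvent t A x \<odot>\<^bsub>t\<^esub> B \<in> carrier_mat n n" if "ht_regular t A x" for x
    using htm_mult_carrier[OF htm_mult_carrier[OF C ht_regular_resolvent(1)[OF A that]] B] .
  have carrier: "the (\<phi> x) \<in> carrier_mat n n" if "ht_regular t A x" for x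
    using CRB[OF that] D by (simp add: \<phi>[OF that])
  have kernel: "the (\<phi> x) + (the (\<phi> y))\<^sup>\<circledast> = (x + y) *\<^sub>h (C \<odot>\<^bsub>t\<^esub> ht_resolvent t A x
      \<odot>\<^bsub>t\<^esub> htm_inv t H \<odot>\<^bsub>t\<^esub> (ht_resolvent t A y)\<^sup>\<circledast> \<odot>\<^bsub>t\<^esub> C\<^sup>\<circledast>)"
    if "ht_associated t n N D C A B H" "ht_regular t A x" "ht_regular t A y" for H x y
    unfolding \<phi>[OF that(2)] \<phi>[OF that(3)]
    by (rule ht_associated_kernel_identity[OF that(1) A C D B that(2,3)])
  have associated_skew: "the (\<phi> x) = - (the (\<phi> (- x)))\<^sup>\<circledast>"
    if H: "ht_associated t n N D C A B H" and x: "ht_regular t A x" "ht_regular t A (- x)" for H x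
  proof -
    have K: "htm_inv t H \<in> carrier_mat N N" by (rule ht_associated_inverse(1)[OF H A C])
    have "C \<odot>\<^bsub>t\<^esub> ht_resolvent t A x \<odot>\<^bsub>t\<^esub> htm_inv t H \<odot>\<^bsub>t\<^esub> (ht_resolvent t A (- x))\<^sup>\<circledast> \<odot>\<^bsub>t\<^esub> C\<^sup>\<circledast>
        \<in> carrier_mat n n"
      using C K ht_regular_resolvent(1)[OF A x(1)] ht_regular_resolvent(1)[OF A x(2)]
      by (intro htm_mult_carrier[of _ n N]) auto
    then have sum: "the (\<phi> x) + (the (\<phi> (- x)))\<^sup>\<circledast> = 0\<^sub>m n n"
      using kernel[OF H x] by simp
    show ?thesis
    proof (rule eq_matI)
      fix i j assume "i < dim_row (- (the (\<phi> (- x)))\<^sup>\<circledast>)" "j < dim_col (- (the (\<phi> (- x)))\<^sup>\<circledast>)"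
      then have ij: "i < n" "j < n" using carrier[OF x(2)] by (auto simp: htm_adj_def)
      have "the (\<phi> x) $$ (i, j) + (the (\<phi> (- x)))\<^sup>\<circledast> $$ (i, j) = 0"
        using arg_cong[OF sum, of "\<lambda>M. M $$ (i, j)"] ij carrier[OF x(2)] by (simp add: htm_adj_def)
      then show "the (\<phi> x) $$ (i, j) = (- (the (\<phi> (- x)))\<^sup>\<circledast>) $$ (i, j)"
        using ij carrier[OF x(2)] by (simp add: htm_adj_def add_eq_0_iff2)
    qed (use carrier[OF x(1)] carrier[OF x(2)] in \<open>auto simp: htm_adj_def\<close>)
  qed
  have skew_associated: "\<exists>H. ht_associated t n N D C A B H"
    if skew: "\<forall>x. x \<in> dom \<phi> \<and> -x \<in> dom \<phi> \<longrightarrow> the (\<phi> x) = - (the (\<phi> (-x)))\<^sup>\<circledast>"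
    using skew[unfolded dom] \<phi>
    by (intro skew_symmetric_imp_associated[OF \<open>t \<noteq> 0\<close> A B C D ctrl obs]) metis
  have unique: "H = H'" if "ht_associated t n N D C A B H" "ht_associated t n N D C A B H'" for H H'
    by (rule ht_associated_unique[OF A B C ctrl that])
  have representation: "the (\<phi> x) = D + x *\<^sub>h (C \<odot>\<^bsub>t\<^esub> ht_resolvent t A x \<odot>\<^bsub>t\<^esub> htm_inv t H \<odot>\<^bsub>t\<^esub> C\<^sup>\<circledast>)"
    if H: "ht_associated t n N D C A B H" and x: "ht_regular t A x" for H x
  proof -
    have Cs: "C\<^sup>\<circledast> \<in> carrier_mat N n" using C by simp
    have "B = htm_inv t H \<odot>\<^bsub>t\<^esub> C\<^sup>\<circledast>" using H by (simp add: ht_associated_def)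
    then have "C \<odot>\<^bsub>t\<^esub> ht_resolvent t A x \<odot>\<^bsub>t\<^esub> B = C \<odot>\<^bsub>t\<^esub> ht_resolvent t A x \<odot>\<^bsub>t\<^esub> htm_inv t H \<odot>\<^bsub>t\<^esub> C\<^sup>\<circledast>"
      using htm_assoc[OF htm_mult_carrier[OF C ht_regular_resolvent(1)[OF A x]]
          ht_associated_inverse(1)[OF H A C] Cs] by simp
    then show ?thesis by (simp add: \<phi>[OF x])
  qed
  have quotient: "(1 / (x + y)) *\<^sub>h (the (\<phi> x) + (the (\<phi> y))\<^sup>\<circledast>) = C \<odot>\<^bsub>t\<^esub> ht_resolvent t A x
      \<odot>\<^bsub>t\<^esub> htm_inv t H \<odot>\<^bsub>t\<^esub> htm_inv t (htm_one N - y *\<^sub>h A\<^sup>\<circledast>) \<odot>\<^bsub>t\<^esub> C\<^sup>\<circledast>"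
    if "ht_associated t n N D C A B H" "ht_regular t A x" "ht_regular t A y" "x + y \<noteq> 0" for H x y
    unfolding kernel[OF that(1-3)] resolvent_adj[OF that(3)] using that(4) by simp
  show ?thesis
  proof (intro conjI iffI allI impI ballI)
    fix x
    assume "\<exists>H. ht_associated t n N D C A B H" "x \<in> dom \<phi> \<and> - x \<in> dom \<phi>"
    then show "the (\<phi> x) = - (the (\<phi> (- x)))\<^sup>\<circledast>" unfolding dom using associated_skew by blast
  next
    fix H H'
    assume "ht_associated t n N D C A B H \<and> ht_associated t n N D C A B H'"
    then show "H = H'" using unique by blast
  next
    fix H x
    assume "ht_associated t n N D C A B H" "x \<in> dom \<phi>"
    then show "the (\<phi> x) = D + x *\<^sub>h (C \<odot>\<^bsub>t\<^esub> htm_inv t (htm_one N - x *\<^sub>h A) \<odot>\<^bsub>t\<^esub> htm_inv t H \<odot>\<^bsub>t\<^esub> C\<^sup>\<circledast>)"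
      unfolding dom resolvent by (rule representation)
  next
    fix H x y
    assume "ht_associated t n N D C A B H" "x \<in> dom \<phi>" "y \<in> dom \<phi>" "x + y \<noteq> 0"
    then show "(1 / (x + y)) *\<^sub>h (the (\<phi> x) + (the (\<phi> y))\<^sup>\<circledast>) =
        C \<odot>\<^bsub>t\<^esub> htm_inv t (htm_one N - x *\<^sub>h A) \<odot>\<^bsub>t\<^esub> htm_inv t H
          \<odot>\<^bsub>t\<^esub> htm_inv t (htm_one N - y *\<^sub>h A\<^sup>\<circledast>) \<odot>\<^bsub>t\<^esub> C\<^sup>\<circledast>"
      unfolding dom resolvent by (rule quotient)
  qed (rule skew_associated)
qed

end
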